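(* Define $p_1:=0$ and $p_k:=\frac{2\log(1+1/k)}{\log(1+2/(k-1))}$ for integers $k\ge 2$, and for $p\in (p_{k-1},p_k]$ define $\tau(p):=k^{1-2/p}(k-1)$. Let $p\in(0,1)$ and let $\rho$ be a symmetric probability measure on $\mathbb{R}$ with finite $p$-th moment such that, for $X\sim\rho$, $\mathbb{P}(X=0)=0$ and one of the following holds: (1) there are $C>0$ and $\alpha_1<2-p$ such that $|\log\mathbb{P}(x\le X\le t x)|\le Cx^{\alpha_1}$ as $x\to \infty$ and $t\downarrow 1$; (2) there are $C>0$ and $\alpha_2<2(1-p)$ such that $|\log\mathbb{P}(|X|<x)|\le C x^{-\alpha_2}$ as $x\to 0$. Then for $\beta>0$, \[ \lim_{n\to\infty}n^{1-2/p}\log \mathcal{Z}_{n,p}(\beta;\rho) = \frac{\beta}{2}\tau(p). \]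
   Context: For $\|x\|_{n,p}:=(\frac1n\sum_{i=1}^n|x_i|^p)^{1/p}$, the self-scaled partition function is $\mathcal{Z}_{n,p}(\beta;\rho) = \int_{\mathbb{R}^{n}} \exp\left(\frac{\beta n}{2}\cdot \frac{|n^{-1}\sum_{i}x_i|^2}{\|x\|_{n,p}^2} - \frac{\beta}{2}\cdot \frac{n^{-1}\sum_{i}x_i^2}{\|x\|_{n,p}^2} \right) \prod_{i=1}^{n}d\rho(x_{i})$. *)

theory Defs
  imports "HOL-Probability.Probability"
begin

definition pk :: "nat \<Rightarrow> real" where
  "pk k = (if k \<le> 1 then 0
           else 2 * ln (1 + 1 / real k) / ln (1 + 2 / (real k - 1)))"

definition tau :: "real \<Rightarrow> real" where
  "tau p = (let k = (THE k::nat. 2 \<le> k \<and> pk (k - 1) < p \<and> p \<le> pk k)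
            in real k powr (1 - 2 / p) * (real k - 1))"

definition norm_np :: "nat \<Rightarrow> real \<Rightarrow> (nat \<Rightarrow> real) \<Rightarrow> real" where
  "norm_np n p x = ((1 / real n) * (\<Sum>i<n. \<bar>x i\<bar> powr p)) powr (1 / p)"

definition Zfun :: "nat \<Rightarrow> real \<Rightarrow> real \<Rightarrow> real measure \<Rightarrow> real" where
  "Zfun n p \<beta> \<rho> =
     (\<integral>x. exp (\<beta> * real n / 2 * ((1 / real n) * (\<Sum>i<n. x i))\<^sup>2 / (norm_np n p x)\<^sup>2
               - \<beta> / 2 * ((1 / real n) * (\<Sum>i<n. (x i)\<^sup>2)) / (norm_np n p x)\<^sup>2)
      \<partial>(PiM {..<n} (\<lambda>_. \<rho>)))"

end

theory Submission
  imports Defs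
begin

text \<open>
  Since \<open>\<parallel>x\<parallel>\<^sup>2 = n powr (- 2 / p) * (\<Sum>i. \<bar>x i\<bar> powr p) powr (2 / p)\<close>, the exponent is
  \<open>\<beta> / 2 * n powr (2 / p - 1)\<close> times the scale-invariant ratio of
  \<open>(\<Sum>i. x i)\<^sup>2 - (\<Sum>i. (x i)\<^sup>2)\<close> and \<open>(\<Sum>i. \<bar>x i\<bar> powr p) powr (2 / p)\<close>, so the limit is governed by
  the supremum of this ratio. At \<open>k\<close> equal coordinates, the others being zero, it is
  \<open>k powr (1 - 2 / p) * (k - 1)\<close>, and \<open>pk k\<close> is exactly the threshold below which passing from \<open>k\<close> to
  \<open>k + 1\<close> does not increase this value. No other point does better: on the simplex in the variables
  \<open>\<bar>x i\<bar> powr p\<close>, two distinct positive coordinates can always be either averaged or merged into one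
  so that the ratio strictly increases, whence at a maximizer all positive coordinates agree.

  The lower bound comes from events of probability at least \<open>exp (- K * n powr \<theta>)\<close> with
  \<open>\<theta> < 2 / p - 1\<close> on which \<open>k\<close> coordinates lie in a short interval \<open>[a, (1 + \<eta>) a]\<close> and the rest is
  negligible: under the tail condition \<open>a\<close> is of order \<open>n powr (1 / p)\<close> and the rest is controlled by
  Markov's inequality; under the small-ball condition \<open>a\<close> is fixed and each remaining coordinate is
  smaller than \<open>\<eta> * a * n powr (- 1 / p)\<close>.
\<close>

definition kval :: "real \<Rightarrow> nat \<Rightarrow> real" where
  "kval p k = real k powr (1 - 2 / p) * (real k - 1)"

subsection \<open>The maximal value at equal coordinates\<close>

lemma ln_Suc_bounds:
  fixes x :: real assumes "x > 0"
  shows "1 / (x + 1) \<le> ln (x + 1) - ln x" "ln (x + 1) - ln x \<le> 1 / x"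
proof -
  have "ln (x / (x + 1)) \<le> x / (x + 1) - 1" using assms by (intro ln_le_minus_one) auto
  thus "1 / (x + 1) \<le> ln (x + 1) - ln x" using assms by (simp add: ln_div field_simps)
  have "ln ((x + 1) / x) \<le> (x + 1) / x - 1" using assms by (intro ln_le_minus_one) auto
  thus "ln (x + 1) - ln x \<le> 1 / x" using assms by (simp add: ln_div field_simps)
qed

text \<open>With \<open>a\<close> and \<open>b\<close> for the numerator and the denominator, the
  derivative has the sign of \<open>a * (z - 1) - b * (z + 1)\<close>. The bounds
  \<open>a \<le> 1 / (z - 1)\<close> and \<open>1 / (z + 1) \<le> b\<close> put 1 between these two
  products. At integers this yields the monotonicity of \<open>pk\<close>.\<close>

lemma ln_ratio_antimono:
  fixes x y :: real assumes "1 < x" "x \<le> y"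
  shows "(ln y - ln (y - 1)) / (ln (y + 1) - ln y) \<le> (ln x - ln (x - 1)) / (ln (x + 1) - ln x)"
proof (rule DERIV_nonpos_imp_nonincreasing[OF assms(2)])
  fix z assume "x \<le> z" "z \<le> y"
  hence z: "z > 1" using assms by auto
  define a where "a = ln z - ln (z - 1)"
  define b where "b = ln (z + 1) - ln z"
  have b: "b > 0" "1 / (z + 1) \<le> b" using z ln_Suc_bounds(1)[of z] by (auto simp: b_def)
  have a: "a \<le> 1 / (z - 1)" using z ln_Suc_bounds(2)[of "z - 1"] by (auto simp: a_def)
  have "((\<lambda>z. (ln z - ln (z - 1)) / (ln (z + 1) - ln z)) has_real_derivative
      ((1 / z - 1 / (z - 1)) * b - a * (1 / (z + 1) - 1 / z)) / (b * b)) (at z)"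
    unfolding a_def b_def using z by (auto intro!: derivative_eq_intros simp: field_simps)
  moreover have "((1 / z - 1 / (z - 1)) * b - a * (1 / (z + 1) - 1 / z)) / (b * b) \<le> 0"
  proof -
    have "a * (z - 1) \<le> b * (z + 1)"
      using a b z by (simp add: field_simps)
    have "(1 / z - 1 / (z - 1)) * b - a * (1 / (z + 1) - 1 / z) 
          = (a * (z - 1) - b * (z + 1)) / (z * (z - 1) * (z + 1))"
      using z by (simp add: divide_simps)
    also have "\<dots> \<le> 0" using \<open>a * (z - 1) \<le> b * (z + 1)\<close> z
      by (intro divide_nonpos_pos) auto
    finally show ?thesis using b by (intro divide_nonpos_pos) auto
  qed
  ultimately show "\<exists>w. ((\<lambda>z. (ln z - ln (z - 1)) / (ln (z + 1) - ln z)) has_real_derivative w) (at z) \<and> w \<le> 0"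
    by blast
qed

text \<open>The logarithm in the denominator of \<open>pk k\<close> telescopes into two consecutive
  increments of \<open>ln\<close>, which exposes the quotient treated in
  \<open>ln_ratio_antimono\<close>.\<close>

lemma pk_eq:
  assumes "2 \<le> k"
  shows "pk k = 2 / (1 + (ln (real k) - ln (real k - 1)) / (ln (real k + 1) - ln (real k)))"
proof -
  have 1: "ln (1 + 1 / real k) = ln (real k + 1) - ln (real k)"
  proof -
    have "1 + 1 / real k = (real k + 1) / real k" using assms by (simp add: field_simps)
    thus ?thesis using assms by (simp add: ln_div)
  qed
  have "1 + 2 / (real k - 1) = (real k + 1) / (real k - 1)" using assms by (simp add: field_simps)
  hence 2: "ln (1 + 2 / (real k - 1)) = ln (real k + 1) - ln (real k - 1)"
    using assms by (simp add: ln_div)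
  have "ln (real k + 1) - ln (real k) > 0" "ln (real k) - ln (real k - 1) > 0" using assms by auto
  thus ?thesis using assms unfolding pk_def 1 2 by (simp add: field_simps)
qed

lemma pk_nonneg: "pk k \<ge> 0"
  by (auto simp: pk_def)

lemma pk_mono: "j \<le> k \<Longrightarrow> pk j \<le> pk k"
proof (cases "2 \<le> j")
  case True
  assume "j \<le> k"
  have "0 < 1 + (ln (real k) - ln (real k - 1)) / (ln (real k + 1) - ln (real k))" if "2 \<le> k" for k
    using that by (intro add_pos_nonneg divide_nonneg_nonneg) auto
  from this[OF True] this[of k] True \<open>j \<le> k\<close>
  have "0 < 1 + (ln (real j) - ln (real j - 1)) / (ln (real j + 1) - ln (real j))"
       "0 < 1 + (ln (real k) - ln (real k - 1)) / (ln (real k + 1) - ln (real k))" by linarith+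
  with ln_ratio_antimono[of "real j" "real k"] True \<open>j \<le> k\<close> show ?thesis
    by (auto simp: pk_eq intro!: divide_left_mono mult_pos_pos)
next
  case False
  hence "pk j = 0" by (auto simp: pk_def)
  thus ?thesis using pk_nonneg by simp
qed

text \<open>The thresholds tend to 1, so the intervals between consecutive ones exhaust (0,1) and
  the description in \<open>tau\<close> has a witness.\<close>

lemma pk_eventually_ge:
  assumes "p < 1" shows "\<exists>k\<ge>2. p \<le> pk k"
proof -
  have "(\<lambda>k. 2 * ln (1 + 1 / real k) / ln (1 + 2 / (real k - 1))) \<longlonglongrightarrow> 1"
    by real_asymp
  hence "\<forall>\<^sub>F k in sequentially. p < 2 * ln (1 + 1 / real k) / ln (1 + 2 / (real k - 1))"
    using assms by (auto simp: order_tendsto_iff)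
  hence "\<forall>\<^sub>F k in sequentially. p < 2 * ln (1 + 1 / real k) / ln (1 + 2 / (real k - 1)) \<and> 2 \<le> k"
    by (intro eventually_conj eventually_ge_at_top)
  then obtain k where "p < 2 * ln (1 + 1 / real k) / ln (1 + 2 / (real k - 1))" "2 \<le> k"
    by (auto simp: eventually_at_top_linorder)
  thus ?thesis by (intro exI[of _ k]) (auto simp: pk_def)
qed

text \<open>For \<open>2 \<le> k\<close> both values are positive and logarithms can be compared.
  With \<open>a\<close>, \<open>b\<close> the increments of \<open>ln\<close> after and before
  \<open>k\<close>, the difference \<open>(1 - 2 / p) * a + b\<close> is nonpositive exactly when
  \<open>p * (a + b) \<le> 2 * a\<close>, and \<open>pk k\<close> is
  \<open>2 * a / (a + b)\<close>.\<close>

lemma kval_Suc_le_iff: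
  assumes "0 < p" "2 \<le> k"
  shows "kval p (Suc k) \<le> kval p k \<longleftrightarrow> p \<le> pk k"
proof -
  define a where "a = ln (real k + 1) - ln (real k)"
  define b where "b = ln (real k) - ln (real k - 1)"
  have ab: "a > 0" "b > 0" using assms by (auto simp: a_def b_def)
  have pos: "kval p (Suc k) > 0" "kval p k > 0" using assms by (auto simp: kval_def)
  have 1: "ln (kval p (Suc k)) = (1 - 2 / p) * ln (real k + 1) + ln (real k)"
    using assms by (simp add: kval_def ln_mult ln_powr add.commute)
  have 2: "ln (kval p k) = (1 - 2 / p) * ln (real k) + ln (real k - 1)"
    using assms by (simp add: kval_def ln_mult ln_powr)
  have "ln (kval p (Suc k)) - ln (kval p k) = (1 - 2 / p) * a + b"
    unfolding 1 2 a_def b_def by (simp add: algebra_simps)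
  hence "ln (kval p (Suc k)) \<le> ln (kval p k) \<longleftrightarrow> (1 - 2 / p) * a + b \<le> 0" by linarith
  also have "\<dots> \<longleftrightarrow> p * (a + b) \<le> 2 * a" using assms by (simp add: field_simps)
  also have "\<dots> \<longleftrightarrow> p \<le> pk k"
    using ab assms unfolding pk_eq[OF assms(2)] a_def[symmetric] b_def[symmetric]
    by (simp add: field_simps)
  finally show ?thesis using pos by simp
qed

text \<open>As \<open>pk\<close> is monotone, \<open>kval p\<close> rises from index 2 up to the
  least \<open>k\<close> with \<open>p \<le> pk k\<close> and never rises afterwards. The same
  monotonicity makes this \<open>k\<close> the only index meeting the description in
  \<open>tau\<close>.\<close>

lemma tau_is_max:
  assumes p: "0 < p" "p < 1"
  obtains k where "2 \<le> k" "tau p = kval p k" "\<And>j. 1 \<le> j \<Longrightarrow> kval p j \<le> kval p k"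
proof -
  define k where "k = (LEAST k. p \<le> pk k)"
  have ex: "\<exists>k. p \<le> pk k" using pk_eventually_ge[OF p(2)] by blast
  have k1: "p \<le> pk k" unfolding k_def using ex by (rule LeastI_ex)
  have k2: "pk j < p" if "j < k" for j using not_less_Least[of j] that unfolding k_def by force
  have "pk 0 = 0" "pk 1 = 0" by (auto simp: pk_def)
  hence k3: "2 \<le> k" using k1 p by (cases "k = 0 \<or> k = 1") auto
  have "(THE k::nat. 2 \<le> k \<and> pk (k - 1) < p \<and> p \<le> pk k) = k"
  proof (rule the_equality)
    show "2 \<le> k \<and> pk (k - 1) < p \<and> p \<le> pk k" using k1 k2[of "k - 1"] k3 by auto
  next
    fix j assume j: "2 \<le> j \<and> pk (j - 1) < p \<and> p \<le> pk j"
    hence "\<not> j < k" using k2[of j] by auto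
    moreover have "\<not> k \<le> j - 1" using pk_mono[of k "j - 1"] k1 j by auto
    ultimately show "j = k" by auto
  qed
  hence tau: "tau p = kval p k" by (simp add: tau_def kval_def)
  have up: "kval p j \<le> kval p k" if "j \<ge> k" for j
    using that
  proof (induction rule: dec_induct)
    case (step j)
    have "p \<le> pk j" using k1 pk_mono[OF step(1)] by simp
    hence "kval p (Suc j) \<le> kval p j" using kval_Suc_le_iff[of p j] p k3 step by auto
    thus ?case using step by simp
  qed auto
  have down: "kval p j \<le> kval p k" if "j \<le> k" "2 \<le> j" for j
    using that
  proof (induction rule: inc_induct)
    case (step j)
    have "\<not> p \<le> pk j" using k2[OF step(2)] by simp
    hence "\<not> kval p (Suc j) \<le> kval p j" using kval_Suc_le_iff[of p j] p step by auto
    thus ?case using step by simp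
  qed auto
  \<comment> \<open>Index 1 lies outside the range of \<open>kval_Suc_le_iff\<close> and is treated
    separately: \<open>kval p 1\<close> is 0.\<close>
  have "kval p 1 \<le> kval p k" using k3 by (simp add: kval_def)
  hence "kval p j \<le> kval p k" if "1 \<le> j" for j
    using up[of j] down[of j] that by (cases "j = 1"; cases "j \<le> k") auto
  with k3 tau that show ?thesis by blast
qed

subsection \<open>Optimization over the simplex\<close>

text \<open>The function \<open>e s = (c - s) powr - \<gamma> - (c + s) powr - \<gamma>\<close> vanishes at 0 and is strictly convex,
  so \<open>e s / s\<close> is strictly increasing.\<close>
lemma odd_part_ratio:
  fixes c s t \<gamma> :: real
  assumes "0 < \<gamma>" "0 < s" "s < t" "t < c"
  shows "t * ((c - s) powr - \<gamma> - (c + s) powr - \<gamma>) < s * ((c - t) powr - \<gamma> - (c + t) powr - \<gamma>)"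
proof -
  define e where "e = (\<lambda>s. (c - s) powr - \<gamma> - (c + s) powr - \<gamma>)"
  define e' where "e' = (\<lambda>s. \<gamma> * ((c - s) powr (- \<gamma> - 1) + (c + s) powr (- \<gamma> - 1)))"
  have De: "(e has_real_derivative e' x) (at x)" if "0 \<le> x" "x < c" for x
    unfolding e_def e'_def using that assms
    by (auto intro!: derivative_eq_intros simp: algebra_simps)
  have De': "(e' has_real_derivative 
      \<gamma> * ((\<gamma> + 1) * ((c - x) powr (- \<gamma> - 2) - (c + x) powr (- \<gamma> - 2)))) (at x)" if "0 \<le> x" "x < c" for x
    unfolding e'_def using that assms
    by (auto intro!: derivative_eq_intros simp: algebra_simps)
  have mono: "e' x < e' y" if "0 < x" "x < y" "y < c" for x y
  proof (rule DERIV_pos_imp_increasing[OF that(2)])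
    fix z assume z: "x \<le> z" "z \<le> y"
    have "(c + z) powr (- \<gamma> - 2) < (c - z) powr (- \<gamma> - 2)"
      using z that assms by (intro powr_less_mono2_neg) auto
    thus "\<exists>w. (e' has_real_derivative w) (at z) \<and> 0 < w"
      using De'[of z] z that assms by (intro exI[of _ "\<gamma> * ((\<gamma> + 1) * ((c - z) powr (- \<gamma> - 2) - (c + z) powr (- \<gamma> - 2)))"]) auto
  qed
  \<comment> \<open>The mean value theorem on the adjacent intervals from 0 to \<open>s\<close> and
    from \<open>s\<close> to \<open>t\<close> orders the two chord slopes; \<open>e 0 = 0\<close>
    turns this into the claim.\<close>
  obtain x where x: "0 < x" "x < s" "e s - e 0 = (s - 0) * e' x"
    using MVT2[of 0 s e e'] De assms by force
  obtain y where y: "s < y" "y < t" "e t - e s = (t - s) * e' y"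
    using MVT2[of s t e e'] De assms by force
  have "e' x < e' y" using mono x y assms by auto
  hence "s * (t - s) * e' x < s * (t - s) * e' y" using assms by simp
  hence "(t - s) * e s < s * (e t - e s)"
    using x y by (simp add: e_def mult_ac)
  thus ?thesis unfolding e_def by (simp add: algebra_simps)
qed

text \<open>The derivative of \<open>h\<close> has the sign of \<open>S * e t - 2 * t\<close> (with \<open>\<gamma> = q - 1\<close> in \<open>e\<close>), which changes
  at most once, from negative to positive.\<close>
lemma pair_smoothing:
  fixes q c s S :: real and h :: "real \<Rightarrow> real"
  defines "h \<equiv> (\<lambda>t. S * ((c + t) powr q + (c - t) powr q) + (c + t) powr q * (c - t) powr q)"
  assumes q: "1 < q" and s: "0 < s" "s < c" and S: "0 \<le> S"
  shows "h s < h 0 \<or> h s < h c"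
proof -
  define e where "e = (\<lambda>t. (c - t) powr (1 - q) - (c + t) powr (1 - q))"
  define h' where "h' = (\<lambda>t. q * ((c + t) * (c - t)) powr (q - 1) * (S * e t - 2 * t))"
  have Dh: "(h has_real_derivative h' t) (at t)" if "0 \<le> t" "t < c" for t
  proof -
    have 1: "(c + t) powr (q - 1) * (c + t) powr (1 - q) = 1" 
            "(c - t) powr (q - 1) * (c - t) powr (1 - q) = 1"
      using that s by (auto simp flip: powr_add)
    have 2: "(c + t) powr q = (c + t) * (c + t) powr (q - 1)"
            "(c - t) powr q = (c - t) * (c - t) powr (q - 1)"
      using that s by (auto simp: powr_mult_base)
    have "(h has_real_derivative (S * (q * (c + t) powr (q - 1) - q * (c - t) powr (q - 1))
       + (q * (c + t) powr (q - 1) * (c - t) powr q - q * (c - t) powr (q - 1) * (c + t) powr q))) (at t)"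
      unfolding h_def using that s
      by (auto intro!: derivative_eq_intros simp: algebra_simps)
    also have "(S * (q * (c + t) powr (q - 1) - q * (c - t) powr (q - 1))
       + (q * (c + t) powr (q - 1) * (c - t) powr q - q * (c - t) powr (q - 1) * (c + t) powr q)) = h' t"
    proof -
      define A B A' B' where "A = (c + t) powr (q - 1)" and "B = (c - t) powr (q - 1)"
        and "A' = (c + t) powr (1 - q)" and "B' = (c - t) powr (1 - q)"
      have "A * A' = 1" "B * B' = 1" using 1 by (auto simp: A_def B_def A'_def B'_def)
      \<comment> \<open>\<open>A'\<close> and \<open>B'\<close> are the reciprocals of
        \<open>A\<close> and \<open>B\<close>, so \<open>A * B\<close> factors out of
        \<open>A - B\<close> and leaves \<open>B' - A'\<close>, which is \<open>e t\<close>.\<close>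
      hence *: "A * B * (S * (B' - A')) = S * (A - B)" by algebra
      have "S * (q * A - q * B) + (q * A * ((c - t) * B) - q * B * ((c + t) * A))
         = q * (S * (A - B)) - q * (A * B) * (2 * t)" by (simp add: algebra_simps)
      also have "\<dots> = q * (A * B) * (S * (B' - A') - 2 * t)"
        unfolding *[symmetric] by (simp add: algebra_simps)
      finally show ?thesis using that s
        by (simp add: h'_def e_def 2 powr_mult A_def B_def A'_def B'_def)
    qed
    finally show ?thesis .
  qed
  have h0: "e 0 = 0" by (simp add: e_def)
  have ratio: "v * e u < u * e v" if "0 < u" "u < v" "v < c" for u v
    using odd_part_ratio[of "q - 1" u v c] that q by (simp add: e_def)
  have prod: "((c + t) * (c - t)) powr (q - 1) > 0" if "0 \<le> t" "t < c" for t
    using that by auto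
  show ?thesis
  \<comment> \<open>Since \<open>e t / t\<close> increases, the sign of
    \<open>S * e t - 2 * t\<close> at \<open>s\<close> settles one side: if it is nonpositive there,
    \<open>h\<close> decreases on the way from 0 to \<open>s\<close>; otherwise \<open>h\<close>
    increases from \<open>s\<close> to \<open>c\<close>.\<close>
  proof (cases "S * e s \<le> 2 * s")
    case True
    have neg: "h' t < 0" if "0 < t" "t < s" for t
    proof -
      have "s * (S * e t) \<le> t * (S * e s)"
        using ratio[of t s] that s S mult_left_mono[of "s * e t" "t * e s" S] by (simp add: mult_ac)
      also have "\<dots> \<le> t * (2 * s)" using True that by (intro mult_left_mono) auto
      finally have le: "s * (S * e t) \<le> s * (2 * t)" by (simp add: mult_ac)
      have "S * e t < 2 * t"
      \<comment> \<open>Multiplying the strict inequality \<open>ratio\<close> by \<open>S\<close>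
        keeps it strict only for \<open>S > 0\<close>; for \<open>S = 0\<close> the claim is just
        \<open>0 < 2 * t\<close>.\<close>
      proof (cases "S = 0")
        case False
        hence "S * (s * e t) < S * (t * e s)" using S ratio[of t s] that s by (intro mult_strict_left_mono) auto
        also have "\<dots> \<le> t * (2 * s)" using mult_left_mono[OF True, of t] that by (simp add: mult_ac)
        finally have "s * (S * e t) < s * (2 * t)" by (simp add: mult_ac)
        thus ?thesis using s by simp
      qed (use that in auto)
      thus ?thesis using prod[of t] that s q unfolding h'_def by (intro mult_pos_neg) auto
    qed
    have "h s < h 0"
    proof (rule DERIV_neg_imp_decreasing_open[OF s(1)])
      show "\<exists>y. (h has_real_derivative y) (at t) \<and> y < 0" if "0 < t" "t < s" for t
        using Dh[of t] neg[of t] that s by auto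
      show "continuous_on {0..s} h"
        using Dh s by (intro DERIV_continuous_on[of _ _ h'] ) (auto intro: has_field_derivative_at_within)
    qed
    thus ?thesis ..
  next
    case False
    have pos: "h' t > 0" if "s < t" "t < c" for t
    proof -
      have "s * (2 * t) < t * (S * e s)" using False that s by (simp add: mult_ac)
      also have "\<dots> \<le> s * (S * e t)"
        using ratio[of s t] that s S mult_left_mono[of "t * e s" "s * e t" S] by (simp add: mult_ac)
      finally have "2 * t < S * e t" using s by simp
      thus ?thesis using prod[of t] that s q unfolding h'_def by (intro mult_pos_pos) auto
    qed
    have "h s < h c"
    proof (rule DERIV_pos_imp_increasing_open[OF s(2)])
      show "\<exists>y. (h has_real_derivative y) (at t) \<and> 0 < y" if "s < t" "t < c" for t
        using Dh[of t] pos[of t] that s by auto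
      \<comment> \<open>\<open>Dh\<close> excludes the endpoint \<open>c\<close>, so continuity up
        to \<open>c\<close> is read off the formula for \<open>h\<close>, whose exponents are
        positive.\<close>
      show "continuous_on {s..c} h"
        unfolding h_def using s q by (auto intro!: continuous_intros continuous_on_powr')
    qed
    thus ?thesis ..
  qed
qed


text \<open>Compactness of the simplex. Its points are total functions forced to 0 outside
  \<open>I\<close>, so that \<open>K\<close> is a closed subset of a product of compact sets over
  the whole index type and Tychonoff's theorem applies.\<close>

lemma simplex_maximum:
  fixes q :: real and I :: "'a set"
  defines "G \<equiv> (\<lambda>y. (\<Sum>i\<in>I. y i powr q)\<^sup>2 - (\<Sum>i\<in>I. (y i powr q)\<^sup>2))"
  defines "K \<equiv> {y. (\<forall>i. y i \<in> (if i \<in> I then {0..1} else {0})) \<and> (\<Sum>i\<in>I. y i) = 1}"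
  assumes I: "finite I" "I \<noteq> {}" and q: "0 < q"
  obtains y where "y \<in> K" "\<And>z. z \<in> K \<Longrightarrow> G z \<le> G y"
proof -
  define B where "B = (\<lambda>i. if i \<in> I then {0..1} else {0::real})"
  have "compactin (product_topology (\<lambda>i. euclidean) UNIV) (PiE UNIV B)"
    unfolding compactin_PiE by (auto simp: B_def)
  hence "compact (PiE UNIV B)" by (simp add: euclidean_product_topology)
  moreover have "closed {y. (\<Sum>i\<in>I. y i) = (1::real)}"
    by (intro closed_Collect_eq continuous_intros continuous_on_product_coordinates)
  moreover have "K = PiE UNIV B \<inter> {y. (\<Sum>i\<in>I. y i) = 1}"
    unfolding K_def B_def PiE_UNIV_domain Pi_def by blast
  ultimately have "compact K" by (simp add: compact_Int_closed)
  moreover have "K \<noteq> {}"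
  proof -
    obtain i where "i \<in> I" using I by blast
    hence "(\<lambda>j. if j = i then 1 else 0) \<in> K" using I by (auto simp: K_def)
    thus ?thesis by blast
  qed
  moreover have "continuous_on K G"
  proof -
    have "continuous_on K (\<lambda>y. y i powr q)" if "i \<in> I" for i
      using q that
      by (intro continuous_on_powr' continuous_on_const continuous_on_product_then_coordinatewise[OF continuous_on_id]) 
         (auto simp: K_def split: if_splits)
    thus ?thesis unfolding G_def by (intro continuous_on_diff continuous_on_power continuous_on_sum)
  qed
  ultimately show ?thesis using continuous_attains_sup[of K G] that by blast
qed

text \<open>At a maximizer \<open>m\<close>, two different positive coordinates would contradict
  \<open>pair_smoothing\<close>. Hence the \<open>k\<close> positive coordinates all equal
  \<open>1 / k\<close>, and the value there is \<open>kval (1 / q) k\<close>.\<close>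

lemma simplex_le:
  fixes q M :: real and I :: "'a set" and y :: "'a \<Rightarrow> real"
  assumes I: "finite I" and q: "1 < q"
    and y: "\<And>i. i \<in> I \<Longrightarrow> 0 \<le> y i" "(\<Sum>i\<in>I. y i) = 1"
    and M: "\<And>k. 1 \<le> k \<Longrightarrow> kval (1 / q) k \<le> M"
  shows "(\<Sum>i\<in>I. y i powr q)\<^sup>2 - (\<Sum>i\<in>I. (y i powr q)\<^sup>2) \<le> M"
proof -
  define G where "G = (\<lambda>y. (\<Sum>i\<in>I. y i powr q)\<^sup>2 - (\<Sum>i\<in>I. (y i powr q)\<^sup>2))"
  define K where "K = {y. (\<forall>i. y i \<in> (if i \<in> I then {0..1::real} else {0})) \<and> (\<Sum>i\<in>I. y i) = 1}"
  have ne: "I \<noteq> {}" using y by auto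
  have "0 < q" using q by simp
  from simplex_maximum[OF I ne this]
  obtain m where m: "m \<in> K" "\<And>z. z \<in> K \<Longrightarrow> G z \<le> G m"
    unfolding K_def G_def by blast
  have m0: "0 \<le> m i" for i using m(1) by (auto simp: K_def split: if_splits)
  have eq: "m i = m j" if ij: "i \<in> I" "j \<in> I" "0 < m j" "m j \<le> m i" for i j
  proof (rule ccontr)
    assume "m i \<noteq> m j"
    hence lt: "m j < m i" using ij by simp
    hence nij: "i \<noteq> j" by auto
    \<comment> \<open>Mean and half-difference of the two coordinates. Along \<open>m'\<close>,
      which preserves their sum, \<open>t = s\<close> is the maximizer itself, \<open>t = 0\<close>
      averages the pair, and \<open>t = c\<close> merges it into coordinate
      \<open>i\<close>.\<close>
    define c s where "c = (m i + m j) / 2" and "s = (m i - m j) / 2"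
    define J where "J = I - {i, j}"
    have IJ: "I = insert i (insert j J)" "i \<notin> insert j J" "j \<notin> J" "finite J"
      using ij nij I by (auto simp: J_def)
    define S where "S = (\<Sum>i\<in>J. m i powr q)"
    define h where "h = (\<lambda>t. S * ((c + t) powr q + (c - t) powr q) + (c + t) powr q * (c - t) powr q)"
    define m' where "m' = (\<lambda>t. m(i := c + t, j := c - t))"
    have cs: "0 < s" "s < c" using lt ij by (auto simp: c_def s_def)
    have m's: "m' s = m" using nij by (auto simp: m'_def c_def s_def fun_eq_iff field_simps)
    have sumJ: "(\<Sum>k\<in>J. F (m' t k)) = (\<Sum>k\<in>J. F (m k))" for t and F :: "real \<Rightarrow> real"
      by (rule sum.cong) (auto simp: m'_def J_def)
    \<comment> \<open>The squares of the two moving terms cancel in \<open>G\<close>. Only their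
      product with each other and their products with \<open>S\<close> depend on \<open>t\<close>,
      and these add up to \<open>2 * h t\<close>.\<close>
    have Gh: "G (m' t) = S\<^sup>2 - (\<Sum>k\<in>J. (m k powr q)\<^sup>2) + 2 * h t" for t
    proof -
      have "m' t i = c + t" "m' t j = c - t" using nij by (auto simp: m'_def)
      thus ?thesis unfolding G_def IJ(1) using IJ(2-4)
        by (simp add: sumJ[of "\<lambda>x. x powr q"] sumJ[of "\<lambda>x. (x powr q)\<^sup>2"] S_def[symmetric] h_def)
           (simp add: power2_eq_square algebra_simps)
    qed
    have K': "m' t \<in> K" if "0 \<le> t" "t \<le> c" for t
    proof -
      have "(\<Sum>k\<in>I. m' t k) = (\<Sum>k\<in>I. m k)" 
        unfolding IJ(1) using IJ(2-4) nij sumJ[of "\<lambda>x. x" t] by (simp add: m'_def c_def)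
      hence 1: "(\<Sum>k\<in>I. m' t k) = 1" using m(1) by (simp add: K_def)
      have nn: "0 \<le> m' t k" for k using m0 that by (auto simp: m'_def)
      have "m' t k \<le> 1" if "k \<in> I" for k
        using member_le_sum[OF that, of "m' t"] nn I 1 by auto
      moreover have "m' t k = 0" if "k \<notin> I" for k
      proof -
        have "m k \<in> (if k \<in> I then {0..1} else {0})" using m(1) by (simp add: K_def)
        thus ?thesis using that ij by (auto simp: m'_def)
      qed
      ultimately show ?thesis using 1 nn by (auto simp: K_def)
    qed
    have "0 \<le> S" by (simp add: S_def sum_nonneg)
    from pair_smoothing[OF q cs this] have "h s < h 0 \<or> h s < h c" unfolding h_def .
    moreover have "h 0 \<le> h s" "h c \<le> h s"
      using m(2)[OF K'[of 0]] m(2)[OF K'[of c]] Gh[of 0] Gh[of c] Gh[of s] m's cs by auto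
    ultimately show False by simp
  qed
  define P where "P = {i \<in> I. 0 < m i}"
  have P: "finite P" "P \<subseteq> I" using I by (auto simp: P_def)
  have restr: "(\<Sum>i\<in>I. F (m i)) = (\<Sum>i\<in>P. F (m i))" if "F 0 = 0" for F :: "real \<Rightarrow> real"
    by (rule sum.mono_neutral_right) (use I m0 that in \<open>auto simp: P_def less_le\<close>)
  have sum1: "(\<Sum>i\<in>P. m i) = 1" using m(1) restr[of "\<lambda>x. x"] by (simp add: K_def)
  then obtain i0 where i0: "i0 \<in> P" by (metis sum.empty zero_neq_one ex_in_conv)
  define c where "c = m i0"
  define k where "k = card P"
  have c: "m i = c" if "i \<in> P" for i
    using eq[of i i0] eq[of i0 i] that i0 by (cases "m i \<le> m i0") (auto simp: P_def c_def)
  have k: "1 \<le> k" using i0 P by (auto simp: k_def Suc_le_eq card_gt_0_iff)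
  have "real k * c = 1" using sum1 c by (simp add: k_def)
  hence ck: "c = 1 / real k" using k by (simp add: field_simps)
  have "G m = (real k * c powr q)\<^sup>2 - real k * (c powr q)\<^sup>2"
    using c q restr[of "\<lambda>x. x powr q"] restr[of "\<lambda>x. (x powr q)\<^sup>2"] by (simp add: G_def k_def)
  also have "\<dots> = real k * (real k - 1) * (c powr q)\<^sup>2"
    by (simp add: power2_eq_square algebra_simps)
  also have "(c powr q)\<^sup>2 = real k powr (- 2 * q)"
    using k by (simp add: ck powr_divide powr_minus_divide powr_powr power_divide flip: powr_numeral)
       (simp add: mult.commute)
  also have "real k * (real k - 1) * real k powr (- 2 * q) = kval (1 / q) k"
    using k by (simp add: kval_def powr_diff powr_minus_divide)
  also have "\<dots> \<le> M" by (rule M[OF k])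
  finally have GM: "G m \<le> M" .
  \<comment> \<open>Membership in \<open>K\<close> demands the value 0 outside \<open>I\<close>,
    where \<open>y\<close> is arbitrary.\<close>
  define z where "z = (\<lambda>i. if i \<in> I then y i else 0)"
  have "y i \<le> 1" if "i \<in> I" for i
    using member_le_sum[OF that, of y] y I by auto
  hence "z \<in> K" using y by (auto simp: z_def K_def)
  from m(2)[OF this] GM show ?thesis by (simp add: G_def z_def)
qed

text \<open>Passing to absolute values can only increase the left side. Then
  \<open>simplex_le\<close> with \<open>q = 1 / p\<close> applies to the normalized weights
  \<open>\<bar>x i\<bar> powr p / S\<close>.\<close>

lemma square_sum_le:
  fixes p M :: real and I :: "'a set" and x :: "'a \<Rightarrow> real"
  assumes I: "finite I" and p: "0 < p" "p < 1"
    and M: "\<And>k. 1 \<le> k \<Longrightarrow> kval p k \<le> M"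
  shows "((\<Sum>i\<in>I. x i)\<^sup>2 - (\<Sum>i\<in>I. (x i)\<^sup>2)) \<le> M * (\<Sum>i\<in>I. \<bar>x i\<bar> powr p) powr (2 / p)"
proof -
  define S where "S = (\<Sum>i\<in>I. \<bar>x i\<bar> powr p)"
  have "(\<Sum>i\<in>I. x i)\<^sup>2 \<le> (\<Sum>i\<in>I. \<bar>x i\<bar>)\<^sup>2"
    using sum_abs[of x I] by (simp add: abs_le_square_iff[symmetric] sum_nonneg)
  hence le: "(\<Sum>i\<in>I. x i)\<^sup>2 - (\<Sum>i\<in>I. (x i)\<^sup>2) \<le> (\<Sum>i\<in>I. \<bar>x i\<bar>)\<^sup>2 - (\<Sum>i\<in>I. \<bar>x i\<bar>\<^sup>2)" by simp
  have "(\<Sum>i\<in>I. \<bar>x i\<bar>)\<^sup>2 - (\<Sum>i\<in>I. \<bar>x i\<bar>\<^sup>2) \<le> M * S powr (2 / p)"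
  proof (cases "S = 0")
    case True
    hence "\<forall>i\<in>I. x i = 0" using I by (simp add: S_def sum_nonneg_eq_0_iff)
    thus ?thesis by (simp add: True)
  next
    case False
    hence S: "S > 0" by (simp add: S_def sum_nonneg order_less_le)
    define y where "y = (\<lambda>i. \<bar>x i\<bar> powr p / S)"
    have yq: "y i powr (1 / p) = \<bar>x i\<bar> / S powr (1 / p)" for i
      using p S by (simp add: y_def powr_divide powr_powr)
    have "(\<Sum>i\<in>I. y i powr (1 / p))\<^sup>2 - (\<Sum>i\<in>I. (y i powr (1 / p))\<^sup>2) \<le> M"
    proof (rule simplex_le[OF I])
      show "(\<Sum>i\<in>I. y i) = 1" using S by (simp add: y_def S_def flip: sum_divide_distrib)
    qed (use p S M in \<open>auto simp: y_def\<close>)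
    hence "((\<Sum>i\<in>I. \<bar>x i\<bar>)\<^sup>2 - (\<Sum>i\<in>I. \<bar>x i\<bar>\<^sup>2)) / (S powr (1 / p))\<^sup>2 \<le> M"
      by (simp add: yq power_divide diff_divide_distrib flip: sum_divide_distrib)
    moreover have "(S powr (1 / p))\<^sup>2 = S powr (2 / p)"
      using S by (simp add: powr_powr flip: powr_numeral)
    ultimately show ?thesis using S by (simp add: field_simps)
  qed
  with le show ?thesis by (simp add: S_def)
qed

section \<open>The scale-invariant ratio and its near-maximizers\<close>

definition ratio :: "real \<Rightarrow> 'a set \<Rightarrow> ('a \<Rightarrow> real) \<Rightarrow> real" where
  "ratio p I x = ((\<Sum>i\<in>I. x i)\<^sup>2 - (\<Sum>i\<in>I. (x i)\<^sup>2)) / (\<Sum>i\<in>I. \<bar>x i\<bar> powr p) powr (2 / p)"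

lemma ratio_le_tau:
  assumes "finite I" "0 < p" "p < 1"
  shows "ratio p I x \<le> tau p"
proof -
  obtain k where k: "2 \<le> k" "tau p = kval p k" "\<And>j. 1 \<le> j \<Longrightarrow> kval p j \<le> kval p k"
    using tau_is_max[OF assms(2,3)] by blast
  \<comment> \<open>Settles the zero vector, where division by zero makes \<open>ratio\<close> equal
    to 0.\<close>
  have "kval p k \<ge> 0" using k(1) by (simp add: kval_def)
  define D where "D = (\<Sum>i\<in>I. \<bar>x i\<bar> powr p) powr (2 / p)"
  have "D \<ge> 0" by (simp add: D_def)
  thus ?thesis using square_sum_le[OF assms, of "kval p k" x] k \<open>kval p k \<ge> 0\<close>
    by (cases "D = 0") (auto simp: ratio_def D_def[symmetric] divide_le_eq)
qed

text \<open>Each factor \<open>y i powr (q - 1)\<close> is at most the same power of the whole sum.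
  With \<open>q = r / p\<close> this turns a bound on the p-th powers of a tail into bounds on its
  higher powers.\<close>

lemma sum_powr_le_powr_sum:
  fixes y :: "'a \<Rightarrow> real"
  assumes "finite A" "1 \<le> q" "\<And>i. i \<in> A \<Longrightarrow> 0 \<le> y i"
  shows "(\<Sum>i\<in>A. y i powr q) \<le> (\<Sum>i\<in>A. y i) powr q"
proof -
  have nn: "(\<Sum>i\<in>A. y i) \<ge> 0" using assms by (simp add: sum_nonneg)
  have base: "z powr q = z * z powr (q - 1)" if "z \<ge> 0" for z :: real
    using that by (simp add: powr_mult_base)
  have "(\<Sum>i\<in>A. y i powr q) = (\<Sum>i\<in>A. y i * y i powr (q - 1))"
    using base assms by auto
  also have "\<dots> \<le> (\<Sum>i\<in>A. y i * (\<Sum>i\<in>A. y i) powr (q - 1))"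
    using assms by (intro sum_mono mult_left_mono powr_mono2 member_le_sum) auto
  also have "\<dots> = (\<Sum>i\<in>A. y i) powr q"
    using base[OF nn] by (simp add: sum_distrib_right)
  finally show ?thesis .
qed

text \<open>Stability of the block configuration. With \<open>S\<close> and \<open>R\<close> the
  sums over \<open>J\<close> and its complement, \<open>S\<close> is at least \<open>k * a\<close>,
  the cross term costs at most \<open>2 * k * t * \<eta> * a\<^sup>2\<close>, the squares are
  bounded from above, and \<open>R\<^sup>2\<close> is dropped. All powers of \<open>a\<close> cancel
  by homogeneity.\<close>

lemma ratio_ge:
  fixes x :: "'a \<Rightarrow> real" and k :: nat
  assumes I: "finite I" "J \<subseteq> I" "card J = k" "1 \<le> k" and p: "0 < p" "p < 1"
    and pos: "0 < a" "0 \<le> \<eta>" "1 \<le> t"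
    and x: "\<And>i. i \<in> J \<Longrightarrow> x i \<in> {a..t * a}"
    and rest: "(\<Sum>i\<in>I - J. \<bar>x i\<bar> powr p) \<le> (\<eta> * a) powr p"
    and N: "0 \<le> (real k)\<^sup>2 - real k * t\<^sup>2 - 2 * real k * t * \<eta> - \<eta>\<^sup>2"
  shows "((real k)\<^sup>2 - real k * t\<^sup>2 - 2 * real k * t * \<eta> - \<eta>\<^sup>2) 
    / (real k * t powr p + \<eta> powr p) powr (2 / p) \<le> ratio p I x"
proof -
  define N where "N = (real k)\<^sup>2 - real k * t\<^sup>2 - 2 * real k * t * \<eta> - \<eta>\<^sup>2"
  define w where "w = real k * t powr p + \<eta> powr p"
  define S where "S = (\<Sum>i\<in>J. x i)"
  define R where "R = (\<Sum>i\<in>I - J. x i)"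
  define D where "D = (\<Sum>i\<in>I. \<bar>x i\<bar> powr p)"
  have J: "finite J" using I finite_subset by blast
  \<comment> \<open>Used with exponent 1 for the sum of the remaining coordinates and with exponent
    2 for their squares.\<close>
  have tail: "(\<Sum>i\<in>I - J. \<bar>x i\<bar> powr r) \<le> (\<eta> * a) powr r" if "p \<le> r" for r
  proof -
    have "(\<Sum>i\<in>I - J. \<bar>x i\<bar> powr r) = (\<Sum>i\<in>I - J. (\<bar>x i\<bar> powr p) powr (r / p))"
      using p by (simp add: powr_powr)
    also have "\<dots> \<le> (\<Sum>i\<in>I - J. \<bar>x i\<bar> powr p) powr (r / p)"
      using that p I by (intro sum_powr_le_powr_sum) auto
    also have "\<dots> \<le> ((\<eta> * a) powr p) powr (r / p)"
      using rest p that by (intro powr_mono2) (auto intro: sum_nonneg)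
    finally show ?thesis using p by (simp add: powr_powr)
  qed
  have R: "\<bar>R\<bar> \<le> \<eta> * a"
  proof -
    have "\<bar>R\<bar> \<le> (\<Sum>i\<in>I - J. \<bar>x i\<bar> powr 1)" by (simp add: R_def sum_abs)
    also have "\<dots> \<le> \<eta> * a" using tail[of 1] p pos by simp
    finally show ?thesis .
  qed
  have R2: "(\<Sum>i\<in>I - J. (x i)\<^sup>2) \<le> \<eta>\<^sup>2 * a\<^sup>2"
    using tail[of 2] p pos by (simp add: power_mult_distrib)
  have S1: "real k * a \<le> S" using sum_mono[of J "\<lambda>_. a" x] x I by (simp add: S_def)
  have S2: "S \<le> real k * t * a" using sum_mono[of J x "\<lambda>_. t * a"] x I by (simp add: S_def mult_ac)
  have "(\<Sum>i\<in>J. (x i)\<^sup>2) \<le> (\<Sum>i\<in>J. (t * a)\<^sup>2)"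
    using x pos by (intro sum_mono power_mono) force+
  hence S3: "(\<Sum>i\<in>J. (x i)\<^sup>2) \<le> real k * t\<^sup>2 * a\<^sup>2"
    using I by (simp add: power_mult_distrib)
  have "(real k * a)\<^sup>2 \<le> S\<^sup>2" using S1 pos by (intro power_mono) auto
  moreover have "\<bar>S * R\<bar> \<le> (real k * t * a) * (\<eta> * a)"
  proof -
    have "0 \<le> real k * a" using pos by simp
    hence "\<bar>S\<bar> \<le> real k * t * a" using S1 S2 by linarith
    thus ?thesis unfolding abs_mult using R pos by (intro mult_mono) auto
  qed
  moreover have "(S + R)\<^sup>2 = S\<^sup>2 + 2 * (S * R) + R\<^sup>2" by (simp add: power2_sum)
  moreover have "N * a\<^sup>2 = (real k * a)\<^sup>2 - 2 * ((real k * t * a) * (\<eta> * a)) - real k * t\<^sup>2 * a\<^sup>2 - \<eta>\<^sup>2 * a\<^sup>2"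
    by (simp add: N_def algebra_simps power2_eq_square)
  moreover have "0 \<le> R\<^sup>2" by simp
  ultimately have num: "N * a\<^sup>2 \<le> (S + R)\<^sup>2 - ((\<Sum>i\<in>J. (x i)\<^sup>2) + (\<Sum>i\<in>I - J. (x i)\<^sup>2))"
    using S3 R2 by linarith
  have split: "(\<Sum>i\<in>I. f i) = (\<Sum>i\<in>J. f i) + (\<Sum>i\<in>I - J. f i)" for f :: "'a \<Rightarrow> real"
    using sum.subset_diff[OF I(2,1), of f] by simp
  have "(\<Sum>i\<in>J. \<bar>x i\<bar> powr p) \<le> (\<Sum>i\<in>J. (t * a) powr p)"
    using x pos p by (intro sum_mono powr_mono2) force+
  hence D1: "D \<le> w * a powr p"
    using rest I pos unfolding D_def split by (simp add: w_def powr_mult algebra_simps)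
  have "(\<Sum>i\<in>J. a powr p) \<le> (\<Sum>i\<in>J. \<bar>x i\<bar> powr p)"
    using x pos p by (intro sum_mono powr_mono2) force+
  moreover have "0 < (\<Sum>i\<in>J. a powr p)" using I pos by simp
  moreover have "0 \<le> (\<Sum>i\<in>I - J. \<bar>x i\<bar> powr p)" by (intro sum_nonneg) auto
  ultimately have D2: "0 < D" unfolding D_def split by linarith
  have w: "0 < w" using I pos by (auto simp: w_def intro!: add_pos_nonneg)
  have "N / w powr (2 / p) = N * a\<^sup>2 / (w * a powr p) powr (2 / p)"
    using w pos p by (simp add: powr_mult powr_powr)
  \<comment> \<open>Replacing the denominator by a smaller one goes in this direction because the
    numerator is nonnegative, by the last hypothesis.\<close>
  also have "\<dots> \<le> N * a\<^sup>2 / D powr (2 / p)"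
    using assms(12) D1 D2 p w by (intro divide_left_mono powr_mono2 mult_nonneg_nonneg mult_pos_pos) (auto simp: N_def)
  also have "\<dots> \<le> ratio p I x"
    unfolding ratio_def D_def[symmetric] using num D2 unfolding S_def R_def
    by (intro divide_right_mono) (simp_all add: split[of x] split[of "\<lambda>i. (x i)\<^sup>2"])
  finally show ?thesis by (simp add: N_def w_def)
qed

text \<open>The bound of \<open>ratio_ge\<close> with \<open>t = 1 + \<eta>\<close> tends to
  \<open>kval p k = tau p\<close> as \<eta> decreases to 0, and its numerator tends to
  \<open>k * (k - 1)\<close>, positive as \<open>2 \<le> k\<close>. The threshold
  \<open>\<eta>0\<close> is uniform in the scale \<open>a\<close>, the vector and the index
  set.\<close>

lemma near_optimal_ratio:
  assumes "0 < p" "p < 1" "0 < \<epsilon>"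
  obtains k \<eta>0 where "0 < \<eta>0"
    "\<And>\<eta> a x I J. \<lbrakk>0 < \<eta>; \<eta> < \<eta>0; 0 < a; finite I; J \<subseteq> I; card J = k;
       \<And>i. i \<in> J \<Longrightarrow> x i \<in> {a..(1 + \<eta>) * a}; (\<Sum>i\<in>I - J. \<bar>x i\<bar> powr p) \<le> (\<eta> * a) powr p\<rbrakk>
       \<Longrightarrow> tau p - \<epsilon> \<le> ratio p I (x :: 'a \<Rightarrow> real)"
proof -
  obtain k where k: "2 \<le> k" "tau p = kval p k" by (rule tau_is_max[OF assms(1,2)])
  define N where "N = (\<lambda>\<eta>. (real k)\<^sup>2 - real k * (1 + \<eta>)\<^sup>2 - 2 * real k * (1 + \<eta>) * \<eta> - \<eta>\<^sup>2)"
  define W where "W = (\<lambda>\<eta>. (real k * (1 + \<eta>) powr p + \<eta> powr p) powr (2 / p))"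
  have N: "(N \<longlongrightarrow> (real k)\<^sup>2 - real k) (at_right 0)"
    unfolding N_def by (auto intro!: tendsto_eq_intros)
  have ev: "eventually ((\<le>) (0::real)) (at_right 0)"
    by (auto simp: eventually_at_right_field intro: exI[of _ 1])
  have "((\<lambda>\<eta>. \<eta> powr p) \<longlongrightarrow> 0) (at_right 0)"
    using assms k ev by (intro tendsto_zero_powrI[of _ _ _ p]) auto
  hence W: "(W \<longlongrightarrow> real k powr (2 / p)) (at_right 0)"
    unfolding W_def using assms k ev by (auto intro!: tendsto_eq_intros)
  have "((\<lambda>\<eta>. N \<eta> / W \<eta>) \<longlongrightarrow> ((real k)\<^sup>2 - real k) / real k powr (2 / p)) (at_right 0)"
    using assms k by (intro tendsto_divide N W) auto
  also have "((real k)\<^sup>2 - real k) / real k powr (2 / p) = kval p k"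
    using assms k by (simp add: kval_def powr_diff power2_eq_square algebra_simps diff_divide_distrib)
  finally have "\<forall>\<^sub>F \<eta> in at_right 0. kval p k - \<epsilon> < N \<eta> / W \<eta>"
    using assms k by (auto simp: order_tendsto_iff)
  moreover have "\<forall>\<^sub>F \<eta> in at_right 0. 0 < N \<eta>"
    using N k(1) by (auto simp: order_tendsto_iff power2_eq_square)
  ultimately have "\<forall>\<^sub>F \<eta> in at_right 0. kval p k - \<epsilon> < N \<eta> / W \<eta> \<and> 0 < N \<eta>"
    by (rule eventually_conj)
  then obtain \<eta>0 where \<eta>0: "0 < \<eta>0" "\<And>\<eta>. 0 < \<eta> \<Longrightarrow> \<eta> < \<eta>0 \<Longrightarrow> kval p k - \<epsilon> < N \<eta> / W \<eta> \<and> 0 < N \<eta>"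
    unfolding eventually_at_right_field by blast
  show ?thesis
  proof (rule that[OF \<eta>0(1)])
    fix \<eta> a :: real and x :: "'a \<Rightarrow> real" and I J
    assume *: "0 < \<eta>" "\<eta> < \<eta>0" "0 < a" "finite I" "J \<subseteq> I" "card J = k"
       "\<And>i. i \<in> J \<Longrightarrow> x i \<in> {a..(1 + \<eta>) * a}" "(\<Sum>i\<in>I - J. \<bar>x i\<bar> powr p) \<le> (\<eta> * a) powr p"
    have "N \<eta> / W \<eta> \<le> ratio p I x"
      unfolding N_def W_def
      by (rule ratio_ge[OF *(4,5,6) _ assms(1,2) *(3) _ _ *(7,8)])
        (use \<eta>0(2)[OF *(1,2)] k(1) *(1) in \<open>simp_all add: N_def\<close>)
    thus "tau p - \<epsilon> \<le> ratio p I x" using \<eta>0(2)[OF *(1,2)] k(2) by linarith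
  qed
qed

subsection \<open>Bounds on the partition function\<close>

text \<open>The squared norm contributes \<open>n powr (2 / p)\<close> and the averaging removes one
  factor \<open>n\<close>. The identity also covers the zero vector, where both sides are 0 by
  division by zero.\<close>

lemma Zfun_exponent:
  assumes "0 < n" "0 < p"
  shows "\<beta> * real n / 2 * ((1 / real n) * (\<Sum>i<n. x i))\<^sup>2 / (norm_np n p x)\<^sup>2
           - \<beta> / 2 * ((1 / real n) * (\<Sum>i<n. (x i)\<^sup>2)) / (norm_np n p x)\<^sup>2
         = \<beta> / 2 * real n powr (2 / p - 1) * ratio p {..<n} x"
proof -
  define D where "D = (\<Sum>i<n. \<bar>x i\<bar> powr p)"
  have "D \<ge> 0" by (auto simp: D_def intro: sum_nonneg)
  have "(norm_np n p x)\<^sup>2 = (D / real n) powr (2 / p)"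
    using \<open>D \<ge> 0\<close> by (cases "D = 0") (auto simp: norm_np_def D_def powr_powr simp flip: powr_numeral)
  also have "\<dots> = D powr (2 / p) / real n powr (2 / p)"
    using \<open>D \<ge> 0\<close> by (simp add: powr_divide)
  finally have norm: "(norm_np n p x)\<^sup>2 = D powr (2 / p) / real n powr (2 / p)" .
  define w where "w = real n powr (2 / p - 1)"
  have w: "real n powr (2 / p) = w * real n" "w > 0"
    using assms by (auto simp: powr_diff w_def)
  have "\<beta> * real n / 2 * (1 / real n * X)\<^sup>2 / (d / (w * real n)) - \<beta> / 2 * (1 / real n * Y) / (d / (w * real n))
      = \<beta> / 2 * w * ((X\<^sup>2 - Y) / d)" for X Y d :: real
    using assms w(2) by (cases "d = 0") (simp_all add: divide_simps power2_eq_square, simp add: algebra_simps)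
  thus ?thesis unfolding norm ratio_def D_def[symmetric] w(1) w_def[symmetric] .
qed

text \<open>The integrand is bounded by its value at \<open>tau p\<close>, which also gives
  integrability; the lower bound keeps only the contribution of \<open>E\<close>.\<close>

lemma Zfun_bounds:
  fixes \<rho> :: "real measure"
  assumes prob: "prob_space \<rho>" and sets: "sets \<rho> = sets borel"
    and p: "0 < p" "p < 1" and \<beta>: "0 < \<beta>" and n: "0 < n"
  defines "P \<equiv> PiM {..<n} (\<lambda>_. \<rho>)" and "c \<equiv> \<beta> / 2 * real n powr (2 / p - 1)"
  shows "Zfun n p \<beta> \<rho> \<le> exp (c * tau p)"
    and "\<And>E v. \<lbrakk>E \<in> sets P; \<And>x. x \<in> E \<Longrightarrow> v \<le> ratio p {..<n} x\<rbrakk>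
           \<Longrightarrow> measure P E * exp (c * v) \<le> Zfun n p \<beta> \<rho>"
proof -
  have P: "prob_space P" unfolding P_def by (intro prob_space_PiM prob)
  note fin = prob_space.finite_measure[OF P]
  have [measurable_cong]: "sets \<rho> = sets borel" by (rule sets)
  have c: "c > 0" using \<beta> n by (simp add: c_def)
  have Z: "Zfun n p \<beta> \<rho> = (\<integral>x. exp (c * ratio p {..<n} x) \<partial>P)"
    unfolding Zfun_def Zfun_exponent[OF n p(1)] c_def P_def ..
  have [measurable]: "ratio p {..<n} \<in> borel_measurable P"
    unfolding ratio_def P_def by measurable
  have le: "exp (c * ratio p {..<n} x) \<le> exp (c * tau p)" for x
    using ratio_le_tau[of "{..<n}" p x] p c by simp
  have int: "integrable P (\<lambda>x. exp (c * ratio p {..<n} x))"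
    using le by (intro finite_measure.integrable_const_bound[OF fin, of _ "exp (c * tau p)"]) auto
  show "Zfun n p \<beta> \<rho> \<le> exp (c * tau p)"
    unfolding Z using le by (intro prob_space.integral_le_const[OF P] int) auto
  fix E v assume E: "E \<in> sets P" "\<And>x. x \<in> E \<Longrightarrow> v \<le> ratio p {..<n} x"
  have "measure P E * exp (c * v) = (\<integral>x. indicator E x * exp (c * v) \<partial>P)"
    using E(1) by simp
  also have "\<dots> \<le> Zfun n p \<beta> \<rho>"
    unfolding Z
  proof (intro integral_mono int)
    show "integrable P (\<lambda>x. indicator E x * exp (c * v))"
      using E(1) by (intro integrable_mult_left integrable_real_indicator)
        (auto simp: finite_measure.emeasure_eq_measure[OF fin])
    show "indicator E x * exp (c * v) \<le> exp (c * ratio p {..<n} x)" for x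
      using E(2)[of x] c by (cases "x \<in> E") auto
  qed
  finally show "measure P E * exp (c * v) \<le> Zfun n p \<beta> \<rho>" .
qed

text \<open>Markov's inequality is applied to \<open>u\<close>, the tail sum multiplied by the
  indicator of the block event \<open>B\<close>. By independence its mean is at most
  \<open>n * q ^ k * m\<close>, so the tail exceeds its budget on at most half of the mass
  \<open>q ^ k\<close> of \<open>B\<close>.\<close>

lemma prob_block_ge:
  fixes \<rho> :: "'a measure" and f :: "'a \<Rightarrow> real"
  assumes prob: "prob_space \<rho>" and f: "integrable \<rho> f" "\<And>x. 0 \<le> f x"
    and A: "A \<in> sets \<rho>" and kn: "k \<le> n" "0 < n" and L: "2 * integral\<^sup>L \<rho> f < L"
  defines "P \<equiv> PiM {..<n} (\<lambda>_. \<rho>)"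
  shows "measure \<rho> A ^ k / 2 \<le> 
    measure P {x \<in> space P. (\<forall>i<k. x i \<in> A) \<and> (\<Sum>i\<in>{..<n} - {..<k}. f (x i)) \<le> L * real n}" (is "_ \<le> measure P ?E")
proof -
  have PS: "product_prob_space (\<lambda>_::nat. \<rho>)" using prob by (rule product_prob_spaceI)
  have SF: "product_sigma_finite (\<lambda>_::nat. \<rho>)"
    using prob by (intro product_sigma_finite.intro prob_space_imp_sigma_finite)
  have P: "prob_space P" unfolding P_def by (intro prob_space_PiM prob)
  note fin = prob_space.finite_measure[OF P] prob_space.finite_measure[OF prob]
  define q where "q = measure \<rho> A"
  define m where "m = integral\<^sup>L \<rho> f"
  have m: "0 \<le> m" using f by (simp add: m_def)
  have Lpos: "0 < L" using L m by (simp add: m_def)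
  have [measurable]: "A \<in> sets \<rho>" "f \<in> borel_measurable \<rho>" using A f by auto
  define B where "B = {x \<in> space P. \<forall>i<k. x i \<in> A}"
  define u where "u = (\<lambda>x. (\<Prod>i<k. indicator A (x i)) * (\<Sum>j\<in>{..<n} - {..<k}. f (x j)) :: real)"
  have comp: "(\<lambda>x. x i) \<in> measurable P \<rho>" if "i < n" for i
    using that unfolding P_def by (intro measurable_component_singleton) auto
  have B_eq: "B = {x \<in> space P. \<forall>i\<in>{..<k}. x i \<in> A}" by (auto simp: B_def)
  have sB: "B \<in> sets P" unfolding B_eq
  proof (rule sets.sets_Collect_finite_All)
    fix i assume "i \<in> {..<k}"
    hence [measurable]: "(\<lambda>x. x i) \<in> measurable P \<rho>" using comp kn by auto
    show "{x \<in> space P. x i \<in> A} \<in> sets P" by measurable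
  qed auto
  have [measurable]: "(\<lambda>x. \<Sum>i\<in>{..<n} - {..<k}. f (x i)) \<in> borel_measurable P"
    using comp by (intro borel_measurable_sum measurable_compose[OF _ \<open>f \<in> borel_measurable \<rho>\<close>]) auto
  have "?E = B \<inter> {x \<in> space P. (\<Sum>i\<in>{..<n} - {..<k}. f (x i)) \<le> L * real n}" by (auto simp: B_def)
  also have "\<dots> \<in> sets P" by (intro sets.Int sB) measurable
  finally have sE: "?E \<in> sets P" .
  have "emeasure P B = (\<Prod>i\<in>{..<k}. emeasure \<rho> A)"
    using product_prob_space.emeasure_PiM_Collect[OF PS, where J = "{..<k}" and X = "\<lambda>_. A" and I = "{..<n}"] kn A unfolding B_eq P_def by auto
  hence B: "measure P B = q ^ k"
    by (simp add: fin[THEN finite_measure.emeasure_eq_measure] q_def ennreal_power)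
  have term1: "integrable P (\<lambda>x. (\<Prod>i<k. indicator A (x i)) * f (x j) :: real) \<and>
     integral\<^sup>L P (\<lambda>x. (\<Prod>i<k. indicator A (x i)) * f (x j)) = q ^ k * m" if j: "j \<in> {..<n} - {..<k}" for j
  proof -
    define g where "g = (\<lambda>i y. if i < k then indicator A y else if i = j then f y else (1::real))"
    have "integrable \<rho> (indicator A :: 'a \<Rightarrow> real)"
      by (rule integrable_real_indicator) (auto simp: fin[THEN finite_measure.emeasure_eq_measure])
    hence gint: "integrable \<rho> (g i)" for i
      using f fin(2) by (cases "i < k"; cases "i = j") (auto simp: g_def intro: finite_measure.integrable_const)
    have *: "(\<Prod>i<n. h i) = (\<Prod>i<k. h i) * h j" if "\<And>i. \<not> i < k \<Longrightarrow> i \<noteq> j \<Longrightarrow> h i = 1" for h :: "nat \<Rightarrow> real"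
    proof -
      have "(\<Prod>i<n. h i) = (\<Prod>i\<in>insert j {..<k}. h i)"
        using j that kn by (intro prod.mono_neutral_right) auto
      thus ?thesis using j by (simp add: mult.commute)
    qed
    have eq: "(\<Prod>i<n. g i (x i)) = (\<Prod>i<k. indicator A (x i)) * f (x j)" for x
      using j *[of "\<lambda>i. g i (x i)"] by (simp add: g_def)
    have "(\<Prod>i<n. integral\<^sup>L \<rho> (g i)) = q ^ k * m"
      using j *[of "\<lambda>i. integral\<^sup>L \<rho> (g i)"] by (simp add: g_def q_def m_def prob_space.prob_space[OF prob])
    moreover have "integrable P (\<lambda>x. \<Prod>i<n. g i (x i))"
      unfolding P_def using gint by (intro product_sigma_finite.product_integrable_prod[OF SF]) auto
    moreover have "integral\<^sup>L P (\<lambda>x. \<Prod>i<n. g i (x i)) = (\<Prod>i<n. integral\<^sup>L \<rho> (g i))"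
      unfolding P_def using gint by (intro product_sigma_finite.product_integral_prod[OF SF]) auto
    ultimately show ?thesis by (simp add: eq)
  qed
  have uint: "integrable P u" unfolding u_def sum_distrib_left using term1 by (intro Bochner_Integration.integrable_sum) auto
  have "integral\<^sup>L P u = (\<Sum>j\<in>{..<n} - {..<k}. q ^ k * m)"
    unfolding u_def sum_distrib_left using term1 by (subst Bochner_Integration.integral_sum) auto
  also have "\<dots> = real (n - k) * (q ^ k * m)" using kn by (simp add: card_Diff_subset)
  also have "\<dots> \<le> real n * (q ^ k * m)" using m by (intro mult_right_mono) (auto simp: q_def)
  finally have u: "integral\<^sup>L P u \<le> real n * (q ^ k * m)" .
  have u0: "0 \<le> u x" for x unfolding u_def using f by (intro mult_nonneg_nonneg prod_nonneg sum_nonneg) auto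
  have "measure P {x \<in> space P. L * real n \<le> u x} \<le> integral\<^sup>L P u / (L * real n)"
    using u0 Lpos kn uint by (intro integral_Markov_inequality_measure[of _ _ "{}"]) auto
  also have "\<dots> \<le> real n * (q ^ k * m) / (L * real n)"
    using u Lpos by (intro divide_right_mono) auto
  also have "\<dots> = q ^ k * (m / L)" using kn by simp
  also have "\<dots> \<le> q ^ k * (1 / 2)" using L Lpos by (intro mult_left_mono) (auto simp: q_def m_def field_simps)
  finally have M: "measure P {x \<in> space P. L * real n \<le> u x} \<le> q ^ k / 2" by simp
  define F where "F = {x \<in> space P. L * real n \<le> u x}"
  have [measurable]: "u \<in> borel_measurable P" using uint by simp
  have sF: "F \<in> sets P" unfolding F_def by measurable
  have "B \<subseteq> ?E \<union> F"
  proof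
    fix x assume x: "x \<in> B"
    hence xB: "x \<in> space P" "\<forall>i<k. x i \<in> A" unfolding B_def by blast+
    have "(\<Prod>i<k. indicator A (x i) :: real) = 1"
      using xB(2) by (intro prod.neutral) (auto simp: indicator_def)
    hence ux: "u x = (\<Sum>i\<in>{..<n} - {..<k}. f (x i))" by (simp only: u_def mult_1)
    show "x \<in> ?E \<union> F"
    proof (cases "L * real n \<le> u x")
      case True
      with xB(1) have "x \<in> F" unfolding F_def by blast
      thus ?thesis ..
    next
      case False
      hence "(\<Sum>i\<in>{..<n} - {..<k}. f (x i)) \<le> L * real n" unfolding ux by linarith
      with xB have "x \<in> ?E" by blast
      thus ?thesis ..
    qed
  qed
  hence "measure P B \<le> measure P (?E \<union> F)"
    by (rule finite_measure.finite_measure_mono[OF fin(1) _ sets.Un[OF sE sF]])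
  also have "\<dots> \<le> measure P ?E + measure P F"
    by (rule measure_Un_le[OF sE sF])
  finally have "q ^ k \<le> measure P ?E + q ^ k / 2" using M unfolding B F_def by linarith
  thus ?thesis unfolding q_def by linarith
qed

text \<open>Otherwise the positive half-line, covered by countably many such intervals with rational
  left endpoints, would be null. By symmetry so would the negative one, and with \<open>{0}\<close>
  null the total mass would be 0.\<close>

lemma symmetric_measure_interval_pos:
  fixes \<rho> :: "real measure"
  assumes prob: "prob_space \<rho>" and sets: "sets \<rho> = sets borel"
    and symm: "distr \<rho> borel uminus = \<rho>" and no_atom0: "measure \<rho> {0} = 0" and t: "1 < t"
  obtains a where "0 < a" "0 < measure \<rho> {a..t * a}"
proof (rule ccontr)
  assume "\<not> thesis"
  with that have "\<not> (0 < a \<and> 0 < measure \<rho> {a..t * a})" for a by blast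
  hence 0: "measure \<rho> {a..t * a} = 0" if "0 < a" for a
    using that measure_nonneg[of \<rho> "{a..t * a}"] by (auto simp: less_le)
  have [measurable_cong]: "sets \<rho> = sets borel" by (rule sets)
  note emeasure_eq = finite_measure.emeasure_eq_measure[OF prob_space.finite_measure[OF prob]]
  have sp: "space \<rho> = UNIV" using sets_eq_imp_space_eq[OF sets] by simp
  have "{0<..} \<subseteq> (\<Union>a\<in>{a\<in>\<rat>. 0 < a}. {a..t * a})"
  proof
    fix x :: real assume "x \<in> {0<..}"
    hence "x / t < x" "0 < x / t" using t by (auto simp: field_simps)
    then obtain a where a: "a \<in> \<rat>" "x / t < a" "a < x" using Rats_dense_in_real by blast
    have "0 < a" using a(2) \<open>0 < x / t\<close> by linarith
    moreover have "x < a * t" using a(2) t by (simp add: pos_divide_less_eq)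
    ultimately have "a \<in> {a\<in>\<rat>. 0 < a}" "x \<in> {a..t * a}" using a by (simp_all add: mult.commute)
    thus "x \<in> (\<Union>a\<in>{a\<in>\<rat>. 0 < a}. {a..t * a})" by blast
  qed
  moreover have "(\<Union>a\<in>{a\<in>\<rat>. 0 < a}. {a..t * a}) \<in> null_sets \<rho>"
  proof (rule null_sets_UN')
    show "countable {a \<in> \<rat>. 0 < (a::real)}" using countable_rat by (rule countable_subset[rotated]) auto
  qed (use 0 sets in \<open>auto simp: null_sets_def emeasure_eq\<close>)
  ultimately have pos: "{0<..} \<in> null_sets \<rho>"
    by (rule null_sets_subset[rotated 2]) (auto simp: sets)
  have "emeasure \<rho> {..<0} = emeasure (distr \<rho> borel uminus) {..<0}" by (simp add: symm)
  also have "\<dots> = emeasure \<rho> {0<..}"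
    using sp by (subst emeasure_distr) (auto simp: sets intro!: arg_cong[of _ _ "emeasure \<rho>"])
  finally have neg: "{..<0} \<in> null_sets \<rho>" using pos by (auto simp: null_sets_def sets)
  have "{0} \<in> null_sets \<rho>" using no_atom0 by (auto simp: null_sets_def emeasure_eq sets)
  with pos neg have "{0<..} \<union> {..<0} \<union> {0} \<in> null_sets \<rho>" by (intro null_sets.Un)
  moreover have "{0<..} \<union> {..<0} \<union> {0} = (UNIV :: real set)" by auto
  ultimately show False using sp prob_space.emeasure_space_1[OF prob] by (auto simp: null_sets_def)
qed

text \<open>After scaling by \<open>n powr (1 - 2 / p)\<close> the cost
  \<open>K * n powr \<theta>\<close> of the event vanishes in the limit, while the gain on it
  becomes exactly \<open>\<beta> / 2 * v\<close>.\<close>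

lemma Zfun_log_bounds:
  fixes \<rho> :: "real measure"
  assumes prob: "prob_space \<rho>" and sets: "sets \<rho> = sets borel"
    and p: "0 < p" "p < 1" and \<beta>: "0 < \<beta>" and \<theta>: "\<theta> < 2 / p - 1" and \<epsilon>: "0 < \<epsilon>"
    and ev: "\<forall>\<^sub>F n in sequentially. \<exists>E\<in>sets (PiM {..<n} (\<lambda>_. \<rho>)).
        (\<forall>x\<in>E. v \<le> ratio p {..<n} x) \<and> exp (- K * real n powr \<theta>) \<le> measure (PiM {..<n} (\<lambda>_. \<rho>)) E"
  shows "\<forall>\<^sub>F n in sequentially. 
      \<beta> / 2 * v - \<epsilon> < real n powr (1 - 2 / p) * ln (Zfun n p \<beta> \<rho>) \<and>
      real n powr (1 - 2 / p) * ln (Zfun n p \<beta> \<rho>) \<le> \<beta> / 2 * tau p"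
proof -
  have "(\<lambda>n. K * real n powr (\<theta> + (1 - 2 / p))) \<longlonglongrightarrow> K * 0"
    using \<theta> by (intro tendsto_mult tendsto_const tendsto_neg_powr filterlim_real_sequentially) auto
  hence "\<forall>\<^sub>F n in sequentially. K * real n powr (\<theta> + (1 - 2 / p)) < \<epsilon>"
    using \<epsilon> by (auto simp: order_tendsto_iff)
  moreover have "\<forall>\<^sub>F n in sequentially. 0 < (n::nat)" by (rule eventually_gt_at_top)
  ultimately show ?thesis using ev
  proof eventually_elim
    case (elim n)
    then obtain E where E: "E \<in> sets (PiM {..<n} (\<lambda>_. \<rho>))" "\<And>x. x \<in> E \<Longrightarrow> v \<le> ratio p {..<n} x"
      "exp (- K * real n powr \<theta>) \<le> measure (PiM {..<n} (\<lambda>_. \<rho>)) E" by blast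
    define c where "c = \<beta> / 2 * real n powr (2 / p - 1)"
    have "exp (- K * real n powr \<theta> + c * v) \<le> measure (PiM {..<n} (\<lambda>_. \<rho>)) E * exp (c * v)"
      unfolding exp_add using E(3) by (intro mult_right_mono) auto
    also have "\<dots> \<le> Zfun n p \<beta> \<rho>"
      unfolding c_def by (rule Zfun_bounds(2)[OF prob sets p \<beta> elim(2) E(1,2)])
    finally have Z: "exp (- K * real n powr \<theta> + c * v) \<le> Zfun n p \<beta> \<rho>" .
    hence Zpos: "0 < Zfun n p \<beta> \<rho>" by (rule less_le_trans[OF exp_gt_zero])
    have "- K * real n powr \<theta> + c * v \<le> ln (Zfun n p \<beta> \<rho>)"
      using Z Zpos by (simp add: ln_ge_iff)
    hence "real n powr (1 - 2 / p) * (- K * real n powr \<theta> + c * v)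
         \<le> real n powr (1 - 2 / p) * ln (Zfun n p \<beta> \<rho>)"
      by (intro mult_left_mono) auto
    moreover have wc: "real n powr (1 - 2 / p) * c = \<beta> / 2"
      using elim(2) by (simp add: c_def flip: powr_add)
    hence "real n powr (1 - 2 / p) * (- K * real n powr \<theta> + c * v)
        = \<beta> / 2 * v - K * real n powr (\<theta> + (1 - 2 / p))"
    proof -
      have "w * (- K * m + c * v) = (w * c) * v - K * (m * w)" for w m by (simp add: algebra_simps)
      with \<open>real n powr (1 - 2 / p) * c = \<beta> / 2\<close> show ?thesis by (simp only: powr_add)
    qed
    moreover have "ln (Zfun n p \<beta> \<rho>) \<le> c * tau p"
      using ln_mono[OF Zfun_bounds(1)[OF prob sets p \<beta> elim(2)] Zpos] by (simp add: c_def)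
    hence "real n powr (1 - 2 / p) * ln (Zfun n p \<beta> \<rho>) \<le> real n powr (1 - 2 / p) * (c * tau p)"
      by (intro mult_left_mono) auto
    hence "real n powr (1 - 2 / p) * ln (Zfun n p \<beta> \<rho>) \<le> \<beta> / 2 * tau p"
      by (simp only: wc mult.assoc[symmetric])
    ultimately show ?case using elim(1) by auto
  qed
qed

subsection \<open>Near-optimal events\<close>

text \<open>The scale \<open>a n\<close> is proportional to \<open>n powr (1 / p)\<close>, so the
  typical tail sum, of order \<open>n\<close>, is within the budget
  \<open>(\<eta> * a n) powr p\<close>. The \<open>k\<close> large coordinates cost order
  \<open>n powr (\<alpha> / p)\<close> in the exponent, and \<open>\<alpha> < 2 - p\<close> says
  \<open>\<alpha> / p < 2 / p - 1\<close>.\<close>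

lemma heavy_tail_events:
  fixes \<rho> :: "real measure"
  assumes prob: "prob_space \<rho>" and sets: "sets \<rho> = sets borel"
    and p: "0 < p" "p < 1" and moment: "integrable \<rho> (\<lambda>x. \<bar>x\<bar> powr p)"
    and \<epsilon>: "0 < \<epsilon>" and C: "0 < C" "\<alpha> < 2 - p" "1 < t0"
    and tail: "\<And>t. 1 < t \<Longrightarrow> t \<le> t0 \<Longrightarrow> \<forall>\<^sub>F x in at_top. measure \<rho> {x..t * x} > 0 \<and>
                    \<bar>ln (measure \<rho> {x..t * x})\<bar> \<le> C * x powr \<alpha>"
  shows "\<exists>K \<theta>. \<theta> < 2 / p - 1 \<and> (\<forall>\<^sub>F n in sequentially. \<exists>E\<in>sets (PiM {..<n} (\<lambda>_. \<rho>)).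
      (\<forall>x\<in>E. tau p - \<epsilon> \<le> ratio p {..<n} x) \<and> exp (- K * real n powr \<theta>) \<le> measure (PiM {..<n} (\<lambda>_. \<rho>)) E)"
proof -
  obtain k \<eta>0 where \<eta>0: "0 < \<eta>0"
    "\<And>\<eta> a x I J. \<lbrakk>0 < \<eta>; \<eta> < \<eta>0; 0 < a; finite I; J \<subseteq> I; card J = k;
       \<And>i. i \<in> J \<Longrightarrow> x i \<in> {a..(1 + \<eta>) * a}; (\<Sum>i\<in>I - J. \<bar>x i\<bar> powr p) \<le> (\<eta> * a) powr p\<rbrakk>
       \<Longrightarrow> tau p - \<epsilon> \<le> ratio p I (x :: nat \<Rightarrow> real)"
    using near_optimal_ratio[OF p \<epsilon>, where 'a = nat] by metis
  define \<eta> where "\<eta> = min (\<eta>0 / 2) (t0 - 1)"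
  have \<eta>: "0 < \<eta>" "\<eta> < \<eta>0" "1 + \<eta> \<le> t0" using \<eta>0(1) C by (auto simp: \<eta>_def)
  define L where "L = 2 * (\<integral>x. \<bar>x\<bar> powr p \<partial>\<rho>) + 1"
  have L: "0 < L" by (simp add: L_def add_nonneg_pos)
  \<comment> \<open>Chosen so that \<open>(\<eta> * a n) powr p\<close> is exactly
    \<open>L * n\<close>, the bound on the tail sum in \<open>prob_block_ge\<close>.\<close>
  define A where "A = L powr (1 / p) / \<eta>"
  have A: "0 < A" using L \<eta> by (simp add: A_def)
  define a where "a = (\<lambda>n. A * real n powr (1 / p))"
  have "filterlim a at_top sequentially"
    unfolding a_def using A p
    by (intro filterlim_tendsto_pos_mult_at_top[OF tendsto_const] 
              filterlim_compose[OF real_powr_at_top filterlim_real_sequentially]) auto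
  moreover have "1 < 1 + \<eta>" using \<eta> by simp
  ultimately have ev: "\<forall>\<^sub>F n in sequentially. measure \<rho> {a n..(1 + \<eta>) * a n} > 0 \<and>
      \<bar>ln (measure \<rho> {a n..(1 + \<eta>) * a n})\<bar> \<le> C * a n powr \<alpha>"
    using \<eta>(3) by (intro eventually_compose_filterlim[OF tail])
  \<comment> \<open>The maximum with 0 ensures \<open>1 \<le> n powr \<theta>\<close>, so that the
    factor 1/2 from Markov's inequality is absorbed as \<open>ln 2\<close> in
    \<open>K\<close>.\<close>
  define \<theta> where "\<theta> = max (\<alpha> / p) 0"
  define K where "K = real k * C * A powr \<alpha> + ln 2"
  have "\<theta> < 2 / p - 1" using C p by (auto simp: \<theta>_def field_simps)
  moreover have "\<forall>\<^sub>F n in sequentially. k \<le> n \<and> 0 < n"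
    by (intro eventually_conj eventually_ge_at_top eventually_gt_at_top)
  hence "\<forall>\<^sub>F n in sequentially. \<exists>E\<in>sets (PiM {..<n} (\<lambda>_. \<rho>)).
      (\<forall>x\<in>E. tau p - \<epsilon> \<le> ratio p {..<n} x) \<and> exp (- K * real n powr \<theta>) \<le> measure (PiM {..<n} (\<lambda>_. \<rho>)) E"
    using ev
  proof eventually_elim
    case (elim n)
    define P where "P = PiM {..<n} (\<lambda>_. \<rho>)"
    define q where "q = measure \<rho> {a n..(1 + \<eta>) * a n}"
    define E where "E = {x \<in> space P. (\<forall>i<k. x i \<in> {a n..(1 + \<eta>) * a n}) \<and>
       (\<Sum>i\<in>{..<n} - {..<k}. \<bar>x i\<bar> powr p) \<le> L * real n}"
    have a: "0 < a n" using A elim by (simp add: a_def)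
    have \<eta>a: "(\<eta> * a n) powr p = L * real n"
      using \<eta> A L p elim by (simp add: a_def A_def powr_mult powr_powr)
    have mE: "q ^ k / 2 \<le> measure P E"
      unfolding q_def E_def P_def
      by (rule prob_block_ge[OF prob moment]) (use elim in \<open>simp_all add: L_def sets\<close>)
    have q: "0 < q" "\<bar>ln q\<bar> \<le> C * a n powr \<alpha>" using elim by (auto simp: q_def)
    have npow: "1 \<le> real n powr \<theta>" "real n powr (\<alpha> / p) \<le> real n powr \<theta>"
      using elim by (auto simp: \<theta>_def ge_one_powr_ge_zero intro!: powr_mono)
    have "a n powr \<alpha> = A powr \<alpha> * real n powr (\<alpha> / p)"
      using A by (simp add: a_def powr_mult powr_powr)
    hence "real k * (C * a n powr \<alpha>) \<le> real k * C * A powr \<alpha> * real n powr \<theta>"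
      using C npow by (simp add: mult_left_mono mult.assoc)
    moreover have "- (real k * (C * a n powr \<alpha>)) \<le> real k * ln q"
      using q mult_left_mono[of "- (C * a n powr \<alpha>)" "ln q" "real k"] by simp
    moreover have "ln 2 \<le> ln 2 * real n powr \<theta>" using npow by simp
    moreover have "K * real n powr \<theta> = real k * C * A powr \<alpha> * real n powr \<theta> + ln 2 * real n powr \<theta>"
      by (simp add: K_def distrib_right)
    ultimately have "- K * real n powr \<theta> \<le> real k * ln q - ln 2"
      by linarith
    hence "exp (- K * real n powr \<theta>) \<le> exp (real k * ln q - ln 2)" by simp
    also have "\<dots> = q ^ k / 2" using q(1) by (simp add: exp_diff exp_of_nat_mult)
    finally have "exp (- K * real n powr \<theta>) \<le> measure P E" using mE by simp
    \<comment> \<open>A non-measurable set would have measure 0 by convention, so the positive lower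
      bound already gives measurability.\<close>
    moreover from this have "E \<in> sets P"
      using measure_notin_sets[of E P] by (metis exp_gt_zero not_le)
    moreover have "tau p - \<epsilon> \<le> ratio p {..<n} x" if "x \<in> E" for x
    proof (rule \<eta>0(2)[where a = "a n" and J = "{..<k}" and \<eta> = \<eta>])
      show "x i \<in> {a n..(1 + \<eta>) * a n}" if "i \<in> {..<k}" for i
        using \<open>x \<in> E\<close> that unfolding E_def by blast
      show "(\<Sum>i\<in>{..<n} - {..<k}. \<bar>x i\<bar> powr p) \<le> (\<eta> * a n) powr p"
        using \<open>x \<in> E\<close> unfolding E_def \<eta>a by blast
    qed (use \<eta> a elim in auto)
    ultimately show ?case unfolding P_def by blast
  qed
  ultimately show ?thesis by blast
qed

text \<open>Here the event is a box: \<open>k\<close> coordinates near a fixed \<open>a\<close>, all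
  others below \<open>\<delta> n\<close>, of order \<open>n powr (- 1 / p)\<close>, so that their
  p-th powers sum to at most \<open>(\<eta> * a) powr p\<close>. Up to \<open>n\<close> factors,
  each costing order \<open>n powr (\<alpha> / p)\<close>, give the exponent
  \<open>1 + \<alpha> / p\<close>, below \<open>2 / p - 1\<close> by
  \<open>\<alpha> < 2 * (1 - p)\<close>.\<close>

lemma small_ball_events:
  fixes \<rho> :: "real measure"
  assumes prob: "prob_space \<rho>" and sets: "sets \<rho> = sets borel"
    and p: "0 < p" "p < 1"
    and symm: "distr \<rho> borel uminus = \<rho>" and no_atom0: "measure \<rho> {0} = 0"
    and \<epsilon>: "0 < \<epsilon>" and C: "0 < C" "\<alpha> < 2 * (1 - p)"
    and ball: "\<forall>\<^sub>F x in at_right 0. measure \<rho> {-x<..<x} > 0 \<and>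
                    \<bar>ln (measure \<rho> {-x<..<x})\<bar> \<le> C * x powr (- \<alpha>)"
  shows "\<exists>K \<theta>. \<theta> < 2 / p - 1 \<and> (\<forall>\<^sub>F n in sequentially. \<exists>E\<in>sets (PiM {..<n} (\<lambda>_. \<rho>)).
      (\<forall>x\<in>E. tau p - \<epsilon> \<le> ratio p {..<n} x) \<and> exp (- K * real n powr \<theta>) \<le> measure (PiM {..<n} (\<lambda>_. \<rho>)) E)"
proof -
  obtain k \<eta>0 where \<eta>0: "0 < \<eta>0"
    "\<And>\<eta> a x I J. \<lbrakk>0 < \<eta>; \<eta> < \<eta>0; 0 < a; finite I; J \<subseteq> I; card J = k;
       \<And>i. i \<in> J \<Longrightarrow> x i \<in> {a..(1 + \<eta>) * a}; (\<Sum>i\<in>I - J. \<bar>x i\<bar> powr p) \<le> (\<eta> * a) powr p\<rbrakk>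
       \<Longrightarrow> tau p - \<epsilon> \<le> ratio p I (x :: nat \<Rightarrow> real)"
    using near_optimal_ratio[OF p \<epsilon>, where 'a = nat] by metis
  define \<eta> where "\<eta> = \<eta>0 / 2"
  have \<eta>: "0 < \<eta>" "\<eta> < \<eta>0" using \<eta>0(1) by (auto simp: \<eta>_def)
  obtain a where a: "0 < a" "0 < measure \<rho> {a..(1 + \<eta>) * a}" 
    using symmetric_measure_interval_pos[OF prob sets symm no_atom0, of "1 + \<eta>"] \<eta> by auto
  define q where "q = measure \<rho> {a..(1 + \<eta>) * a}"
  define \<delta> where "\<delta> = (\<lambda>n. \<eta> * a * real n powr (- (1 / p)))"
  have "\<delta> \<longlonglongrightarrow> \<eta> * a * 0"
    unfolding \<delta>_def using p by (intro tendsto_mult tendsto_const tendsto_neg_powr filterlim_real_sequentially) auto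
  moreover have "\<forall>\<^sub>F n in sequentially. 0 < \<delta> n"
    using eventually_gt_at_top[of 0] by eventually_elim (use \<eta> a in \<open>simp add: \<delta>_def\<close>)
  ultimately have "filterlim \<delta> (at_right 0) sequentially"
    by (auto simp: filterlim_at elim: eventually_mono)
  with ball have ev: "\<forall>\<^sub>F n in sequentially. measure \<rho> {- \<delta> n<..<\<delta> n} > 0 \<and>
      \<bar>ln (measure \<rho> {- \<delta> n<..<\<delta> n})\<bar> \<le> C * \<delta> n powr (- \<alpha>)"
    by (rule eventually_compose_filterlim)
  \<comment> \<open>The maximum with 0 lets \<open>n powr \<theta>\<close> dominate the fixed cost
    of the \<open>k\<close> large coordinates.\<close>
  define \<theta> where "\<theta> = max (1 + \<alpha> / p) 0"
  define K where "K = real k * \<bar>ln q\<bar> + C * (\<eta> * a) powr (- \<alpha>)"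
  have "\<alpha> / p < 2 * (1 - p) / p" using C p by (intro divide_strict_right_mono)
  also have "\<dots> = 2 / p - 2" using p by (simp add: field_simps)
  finally have "1 + \<alpha> / p < 2 / p - 1" by simp
  hence "\<theta> < 2 / p - 1" using p by (auto simp: \<theta>_def)
  moreover have "\<forall>\<^sub>F n in sequentially. k \<le> n \<and> 0 < n"
    by (intro eventually_conj eventually_ge_at_top eventually_gt_at_top)
  hence "\<forall>\<^sub>F n in sequentially. \<exists>E\<in>sets (PiM {..<n} (\<lambda>_. \<rho>)).
      (\<forall>x\<in>E. tau p - \<epsilon> \<le> ratio p {..<n} x) \<and> exp (- K * real n powr \<theta>) \<le> measure (PiM {..<n} (\<lambda>_. \<rho>)) E"
    using ev
  proof eventually_elim
    case (elim n)
    define P where "P = PiM {..<n} (\<lambda>_. \<rho>)"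
    have PS: "finite_product_prob_space (\<lambda>_. \<rho>) {..<n}"
      using prob by (intro finite_product_prob_space.intro finite_product_sigma_finite.intro
          finite_product_sigma_finite_axioms.intro product_prob_spaceI product_sigma_finite.intro
          prob_space_imp_sigma_finite finite_lessThan)
    define r where "r = measure \<rho> {- \<delta> n<..<\<delta> n}"
    define X where "X = (\<lambda>i. if i < k then {a..(1 + \<eta>) * a} else {- \<delta> n<..<\<delta> n})"
    define E where "E = (\<Pi>\<^sub>E i\<in>{..<n}. X i)"
    have \<delta>: "0 < \<delta> n" using \<eta> a elim by (simp add: \<delta>_def)
    have E: "E \<in> sets P" unfolding E_def P_def by (intro sets_PiM_I_finite) (auto simp: X_def sets)
    have "measure P E = (\<Prod>i<n. measure \<rho> (X i))"
      unfolding E_def P_def by (intro finite_product_prob_space.prob_times[OF PS]) (auto simp: X_def sets)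
    also have "\<dots> = (\<Prod>i<k. measure \<rho> (X i)) * (\<Prod>i\<in>{..<n} - {..<k}. measure \<rho> (X i))"
      using elim by (subst prod.subset_diff[of "{..<k}"]) auto
    also have "(\<Prod>i<k. measure \<rho> (X i)) = q ^ k" by (simp add: X_def q_def)
    also have "(\<Prod>i\<in>{..<n} - {..<k}. measure \<rho> (X i)) = r ^ (n - k)"
      using elim by (simp add: X_def r_def card_Diff_subset)
    finally have mE: "measure P E = q ^ k * r ^ (n - k)" .
    have q: "0 < q" using a by (simp add: q_def)
    have r: "0 < r" "\<bar>ln r\<bar> \<le> C * \<delta> n powr (- \<alpha>)" using elim by (auto simp: r_def)
    have npow: "1 \<le> real n powr \<theta>" "real n powr (1 + \<alpha> / p) \<le> real n powr \<theta>"
      using elim by (auto simp: \<theta>_def ge_one_powr_ge_zero intro!: powr_mono)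
    have "\<delta> n powr (- \<alpha>) = (\<eta> * a) powr (- \<alpha>) * real n powr (\<alpha> / p)"
      using \<eta> a by (simp add: \<delta>_def powr_mult powr_powr)
    hence "real n * (C * \<delta> n powr (- \<alpha>)) = C * (\<eta> * a) powr (- \<alpha>) * real n powr (1 + \<alpha> / p)"
      using elim by (simp add: powr_add)
    also have "\<dots> \<le> C * (\<eta> * a) powr (- \<alpha>) * real n powr \<theta>"
      using C npow by (intro mult_left_mono) auto
    finally have 1: "real n * (C * \<delta> n powr (- \<alpha>)) \<le> C * (\<eta> * a) powr (- \<alpha>) * real n powr \<theta>" .
    have "real (n - k) * \<bar>ln r\<bar> \<le> real n * (C * \<delta> n powr (- \<alpha>))"
      using r by (intro mult_mono) auto
    moreover have "- (real (n - k) * \<bar>ln r\<bar>) \<le> real (n - k) * ln r"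
      using mult_left_mono[of "- \<bar>ln r\<bar>" "ln r" "real (n - k)"] by simp
    moreover have "- (real k * \<bar>ln q\<bar>) \<le> real k * ln q"
      using mult_left_mono[of "- \<bar>ln q\<bar>" "ln q" "real k"] by simp
    moreover have "real k * \<bar>ln q\<bar> \<le> real k * \<bar>ln q\<bar> * real n powr \<theta>"
      using npow mult_left_mono[of 1 "real n powr \<theta>" "real k * \<bar>ln q\<bar>"] by simp
    moreover have "K * real n powr \<theta> = real k * \<bar>ln q\<bar> * real n powr \<theta> + C * (\<eta> * a) powr (- \<alpha>) * real n powr \<theta>"
      by (simp add: K_def distrib_right)
    ultimately have "- K * real n powr \<theta> \<le> real k * ln q + real (n - k) * ln r"
      using 1 by linarith
    hence "exp (- K * real n powr \<theta>) \<le> exp (real k * ln q + real (n - k) * ln r)" by simp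
    also have "\<dots> = q ^ k * r ^ (n - k)" using q r(1) by (simp only: exp_add exp_of_nat_mult exp_ln)
    finally have "exp (- K * real n powr \<theta>) \<le> measure P E" using mE by simp
    moreover have "tau p - \<epsilon> \<le> ratio p {..<n} x" if "x \<in> E" for x
    proof (rule \<eta>0(2)[where a = a and J = "{..<k}" and \<eta> = \<eta>])
      have X: "x i \<in> X i" if "i < n" for i using \<open>x \<in> E\<close> that by (auto simp: E_def)
      show "x i \<in> {a..(1 + \<eta>) * a}" if "i \<in> {..<k}" for i
        using X[of i] that elim by (auto simp: X_def)
      have "(\<Sum>i\<in>{..<n} - {..<k}. \<bar>x i\<bar> powr p) \<le> (\<Sum>i\<in>{..<n} - {..<k}. \<delta> n powr p)"
      proof (intro sum_mono powr_mono2)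
        fix i assume "i \<in> {..<n} - {..<k}"
        thus "\<bar>x i\<bar> \<le> \<delta> n" using X[of i] by (auto simp: X_def)
      qed (use p in auto)
      also have "\<dots> \<le> real n * \<delta> n powr p"
        by (auto simp: card_Diff_subset intro!: mult_right_mono diff_le_self)
      also have "\<dots> = (\<eta> * a) powr p * (real n * real n powr (- 1))"
        using \<eta> a p by (simp add: \<delta>_def powr_mult powr_powr)
      also have "real n * real n powr (- 1) = 1" using elim by (simp add: powr_minus)
      also have "(\<eta> * a) powr p * 1 = (\<eta> * a) powr p" by simp
      finally show "(\<Sum>i\<in>{..<n} - {..<k}. \<bar>x i\<bar> powr p) \<le> (\<eta> * a) powr p" .
    qed (use \<eta> a elim in auto)
    ultimately show ?case using E unfolding P_def by blast
  qed
  ultimately show ?thesis by blast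
qed

section \<open>Uniting the two conditions and passing to the limit\<close>

lemma near_optimal_events:
  fixes \<rho> :: "real measure"
  assumes p: "0 < p" "p < 1"
    and prob: "prob_space \<rho>"
    and sets: "sets \<rho> = sets borel"
    and symm: "distr \<rho> borel uminus = \<rho>"
    and moment: "integrable \<rho> (\<lambda>x. \<bar>x\<bar> powr p)"
    and no_atom0: "measure \<rho> {0} = 0"
    and cond: "(\<exists>C>0. \<exists>\<alpha>1 < 2 - p. \<exists>t0>1. \<forall>t. 1 < t \<and> t \<le> t0 \<longrightarrow>
                 (\<forall>\<^sub>F x in at_top. measure \<rho> {x..t * x} > 0 \<and>
                    \<bar>ln (measure \<rho> {x..t * x})\<bar> \<le> C * x powr \<alpha>1))
             \<or> (\<exists>C>0. \<exists>\<alpha>2 < 2 * (1 - p).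
                 (\<forall>\<^sub>F x in at_right 0. measure \<rho> {-x<..<x} > 0 \<and>
                    \<bar>ln (measure \<rho> {-x<..<x})\<bar> \<le> C * x powr (- \<alpha>2)))"
    and \<epsilon>: "0 < \<epsilon>"
  shows "\<exists>K \<theta>. \<theta> < 2 / p - 1 \<and> (\<forall>\<^sub>F n in sequentially. \<exists>E\<in>sets (PiM {..<n} (\<lambda>_. \<rho>)).
      (\<forall>x\<in>E. tau p - \<epsilon> \<le> ratio p {..<n} x) \<and> exp (- K * real n powr \<theta>) \<le> measure (PiM {..<n} (\<lambda>_. \<rho>)) E)"
  using cond
proof (elim disjE exE conjE)
  fix C \<alpha> t0 assume "0 < C" "\<alpha> < 2 - p" "1 < t0" "\<forall>t. 1 < t \<and> t \<le> t0 \<longrightarrow>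
             (\<forall>\<^sub>F x in at_top. measure \<rho> {x..t * x} > 0 \<and>
                \<bar>ln (measure \<rho> {x..t * x})\<bar> \<le> C * x powr \<alpha>)"
  thus ?thesis by (intro heavy_tail_events[OF prob sets p moment \<epsilon>]) auto
next
  fix C \<alpha> assume *: "0 < C" "\<alpha> < 2 * (1 - p)" "\<forall>\<^sub>F x in at_right 0. measure \<rho> {-x<..<x} > 0 \<and>
                \<bar>ln (measure \<rho> {-x<..<x})\<bar> \<le> C * x powr (- \<alpha>)"
  show ?thesis by (rule small_ball_events[OF prob sets p symm no_atom0 \<epsilon> *])
qed

theorem theorem1p14:
  fixes p \<beta> :: real and \<rho> :: "real measure"
  assumes p: "0 < p" "p < 1"
    and prob: "prob_space \<rho>"
    and sets: "sets \<rho> = sets borel"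
    and symm: "distr \<rho> borel uminus = \<rho>"
    and moment: "integrable \<rho> (\<lambda>x. \<bar>x\<bar> powr p)"
    and no_atom0: "measure \<rho> {0} = 0"
    and cond: "(\<exists>C>0. \<exists>\<alpha>1 < 2 - p. \<exists>t0>1. \<forall>t. 1 < t \<and> t \<le> t0 \<longrightarrow>
                 (\<forall>\<^sub>F x in at_top. measure \<rho> {x..t * x} > 0 \<and>
                    \<bar>ln (measure \<rho> {x..t * x})\<bar> \<le> C * x powr \<alpha>1))
             \<or> (\<exists>C>0. \<exists>\<alpha>2 < 2 * (1 - p).
                 (\<forall>\<^sub>F x in at_right 0. measure \<rho> {-x<..<x} > 0 \<and>
                    \<bar>ln (measure \<rho> {-x<..<x})\<bar> \<le> C * x powr (- \<alpha>2)))"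
    and beta: "\<beta> > 0"
  shows "(\<lambda>n. real n powr (1 - 2 / p) * ln (Zfun n p \<beta> \<rho>)) \<longlonglongrightarrow> \<beta> / 2 * tau p"
proof (rule tendstoI)
  fix e :: real assume e: "0 < e"
  \<comment> \<open>Losing \<epsilon> in the ratio costs
    \<open>\<beta> / 2 * \<epsilon> = e / 2\<close> in the limit; the other \<open>e / 2\<close>
    pays for the probability of the event.\<close>
  define \<epsilon> where "\<epsilon> = e / \<beta>"
  have \<epsilon>: "0 < \<epsilon>" using e beta by (simp add: \<epsilon>_def)
  from near_optimal_events[OF p prob sets symm moment no_atom0 cond \<epsilon>]
  obtain K \<theta> where K: "\<theta> < 2 / p - 1" "\<forall>\<^sub>F n in sequentially. \<exists>E\<in>sets (PiM {..<n} (\<lambda>_. \<rho>)).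
      (\<forall>x\<in>E. tau p - \<epsilon> \<le> ratio p {..<n} x) \<and> exp (- K * real n powr \<theta>) \<le> measure (PiM {..<n} (\<lambda>_. \<rho>)) E"
    by blast
  have "0 < e / 2" using e by simp
  from Zfun_log_bounds[OF prob sets p beta K(1) this K(2)]
  show "\<forall>\<^sub>F n in sequentially.
      dist (real n powr (1 - 2 / p) * ln (Zfun n p \<beta> \<rho>)) (\<beta> / 2 * tau p) < e"
  proof eventually_elim
    case (elim n)
    have "\<beta> / 2 * (tau p - \<epsilon>) - e / 2 = \<beta> / 2 * tau p - e"
      using beta by (simp add: \<epsilon>_def field_simps)
    with elim show ?case using e by (simp add: dist_real_def)
  qed
qed

end
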